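(* Let $p \in \{1,2\}$, let $N \in \mathbb{N}$, and let $A$ be a compact subspace of $\ell_p^N$. Then the magnitude dimension of $A$ satisfies $\dim A \leq N$, with equality if $A$ has positive ($N$-dimensional) Lebesgue measure.
   Context: $\mathbb{N} = \{0,1,2,\dots\}$, and $\ell_p^N$ is $\mathbb{R}^N$ with the metric induced by the $p$-norm $\|x\|_p = (\sum_r |x_r|^p)^{1/p}$. For a finite metric space $A$, the similarity matrix $\zeta_A \in \mathbb{R}^{A\times A}$ is $\zeta_A(a,b) = e^{-d(a,b)}$. A weighting on $A$ is a function $w\colon A \to \mathbb{R}$ with $\sum_{b\in A} \zeta_A(a,b) w(b) = 1$ for all $a \in A$. If $A$ admits a weighting, its magnitude is $|A| = \sum_{a \in A} w(a)$, which is independent of the choice of weighting $w$. A finite metric space $A$ is positive definite if $\zeta_A$ is (strictly) positive definite; then it has magnitude. A metric space is positive definite if each of its finite subspaces is. The magnitude of a compact positive definite metric space $A$ is $|A| = \sup\{|B| : B \text{ a finite subspace of } A\} \in [0,\infty]$. For $t>0$, $tA$ denotes the metric space with the same points as $A$ and $d_{tA} = t\, d_A$; $A$ is stably positive definite if $tA$ is positive definite for all $t>0$. All subspaces of $\ell_1^N$ and $\ell_2^N$ are stably positive definite. The growth of a function $f\colon (0,\infty) \to [0,\infty]$ is $\inf\{\nu \in \mathbb{R} : f(t)/t^\nu \text{ is bounded (by a finite constant) for all sufficiently large } t\} \in [-\infty,\infty]$. The (magnitude) dimension $\dim A$ of a stably positive definite compact metric space $A$ is the growth of its magnitude function $t \mapsto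 |tA|$. *)

theory Defs
  imports "HOL-Analysis.Analysis"
begin

text \<open>
  A (sub)space is a set \<open>A\<close> together with a distance function \<open>d\<close>; only the values of \<open>d\<close> on
  \<open>A \<times> A\<close> matter.
\<close>

definition similarity :: "('a \<Rightarrow> 'a \<Rightarrow> real) \<Rightarrow> 'a \<Rightarrow> 'a \<Rightarrow> real" where
  "similarity d a b = exp (- d a b)"

definition weighting :: "('a \<Rightarrow> 'a \<Rightarrow> real) \<Rightarrow> 'a set \<Rightarrow> ('a \<Rightarrow> real) \<Rightarrow> bool" where
  "weighting d A w \<longleftrightarrow> (\<forall>a\<in>A. (\<Sum>b\<in>A. similarity d a b * w b) = 1)"

text \<open>
  The total weight is the same for all weightings, by symmetry of \<^term>\<open>similarity d\<close>, so the
  description below is proper as soon as some weighting exists.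
\<close>

definition finite_magnitude :: "('a \<Rightarrow> 'a \<Rightarrow> real) \<Rightarrow> 'a set \<Rightarrow> real" where
  "finite_magnitude d A = (THE m. \<exists>w. weighting d A w \<and> m = (\<Sum>a\<in>A. w a))"

definition finite_positive_definite :: "('a \<Rightarrow> 'a \<Rightarrow> real) \<Rightarrow> 'a set \<Rightarrow> bool" where
  "finite_positive_definite d A \<longleftrightarrow> finite A \<and>
     (\<forall>x :: 'a \<Rightarrow> real. (\<exists>a\<in>A. x a \<noteq> 0) \<longrightarrow>
        (\<Sum>a\<in>A. \<Sum>b\<in>A. x a * similarity d a b * x b) > 0)"

definition positive_definite :: "('a \<Rightarrow> 'a \<Rightarrow> real) \<Rightarrow> 'a set \<Rightarrow> bool" where
  "positive_definite d A \<longleftrightarrow> (\<forall>B\<subseteq>A. finite B \<longrightarrow> finite_positive_definite d B)"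

text \<open>
  Magnitude and magnitude dimension are left unspecified outside the positive definite,
  respectively stably positive definite, spaces.
\<close>

definition magnitude :: "('a \<Rightarrow> 'a \<Rightarrow> real) \<Rightarrow> 'a set \<Rightarrow> ereal" where
  "magnitude d A =
     (if positive_definite d A
      then (SUP B\<in>{B. B \<subseteq> A \<and> finite B}. ereal (finite_magnitude d B))
      else undefined)"

definition scale_dist :: "real \<Rightarrow> ('a \<Rightarrow> 'a \<Rightarrow> real) \<Rightarrow> 'a \<Rightarrow> 'a \<Rightarrow> real" where
  "scale_dist t d a b = t * d a b"

definition stably_positive_definite :: "('a \<Rightarrow> 'a \<Rightarrow> real) \<Rightarrow> 'a set \<Rightarrow> bool" where
  "stably_positive_definite d A \<longleftrightarrow> (\<forall>t>0. positive_definite (scale_dist t d) A)"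

text \<open>The infimum is taken in the extended reals: it is \<open>\<infinity>\<close> if no exponent works, and may be \<open>-\<infinity>\<close>.\<close>

definition growth :: "(real \<Rightarrow> ereal) \<Rightarrow> ereal" where
  "growth f = (INF \<nu>\<in>{\<nu> :: real. \<exists>C :: real. eventually (\<lambda>t. \<bar>f t / ereal (t powr \<nu>)\<bar> \<le> ereal C) at_top}.
     ereal \<nu>)"

definition magnitude_dimension :: "('a \<Rightarrow> 'a \<Rightarrow> real) \<Rightarrow> 'a set \<Rightarrow> ereal" where
  "magnitude_dimension d A =
     (if stably_positive_definite d A
      then growth (\<lambda>t. magnitude (scale_dist t d) A)
      else undefined)"

text \<open>
  Points of \<open>\<real>\<^sup>N\<close> are functions on \<open>{..<N}\<close>, extended by \<^term>\<open>undefined\<close>. Unlike with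
  type-indexed vectors, \<open>N = 0\<close> is allowed, and the points are exactly those of the product measure
  below.
\<close>

definition lp_space :: "nat \<Rightarrow> (nat \<Rightarrow> real) set" where
  "lp_space N = ({..<N} \<rightarrow>\<^sub>E UNIV)"

definition lp_norm :: "real \<Rightarrow> nat \<Rightarrow> (nat \<Rightarrow> real) \<Rightarrow> real" where
  "lp_norm p N x = (\<Sum>r<N. \<bar>x r\<bar> powr p) powr (1 / p)"

definition lp_dist :: "real \<Rightarrow> nat \<Rightarrow> (nat \<Rightarrow> real) \<Rightarrow> (nat \<Rightarrow> real) \<Rightarrow> real" where
  "lp_dist p N x y = lp_norm p N (\<lambda>r. x r - y r)"

definition lp_topology :: "real \<Rightarrow> nat \<Rightarrow> (nat \<Rightarrow> real) topology" where
  "lp_topology p N = Metric_space.mtopology (lp_space N) (lp_dist p N)"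

definition lebesgue_power :: "nat \<Rightarrow> (nat \<Rightarrow> real) measure" where
  "lebesgue_power N = completion (PiM {..<N} (\<lambda>_. lborel))"

lemma space_lebesgue_power: "space (lebesgue_power N) = lp_space N"
  by (simp add: lebesgue_power_def lp_space_def space_PiM)

lemma lp_norm_1: "lp_norm 1 N x = (\<Sum>r<N. \<bar>x r\<bar>)"
  by (simp add: lp_norm_def sum_nonneg)

lemma lp_norm_2: "lp_norm 2 N x = L2_set x {..<N}"
  by (simp add: lp_norm_def L2_set_def powr_half_sqrt sum_nonneg)

lemma Metric_space_lp:
  assumes "p \<in> {1, 2}"
  shows "Metric_space (lp_space N) (lp_dist p N)"
proof
  fix x y z :: "nat \<Rightarrow> real"
  show "0 \<le> lp_dist p N x y"
    by (simp add: lp_dist_def lp_norm_def)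
  show "lp_dist p N x y = lp_dist p N y x"
    by (simp add: lp_dist_def lp_norm_def abs_minus_commute)
  show "lp_dist p N x y = 0 \<longleftrightarrow> x = y" if "x \<in> lp_space N" "y \<in> lp_space N"
  proof -
    have "lp_dist p N x y = 0 \<longleftrightarrow> (\<forall>r<N. x r = y r)"
      using assms
      by (auto simp: lp_dist_def lp_norm_1 lp_norm_2 sum_nonneg_eq_0_iff L2_set_eq_0_iff)
    also have "\<dots> \<longleftrightarrow> x = y"
      using that unfolding lp_space_def by (metis PiE_ext lessThan_iff)
    finally show ?thesis .
  qed
  show "lp_dist p N x z \<le> lp_dist p N x y + lp_dist p N y z"
  proof -
    have split: "(\<lambda>r. x r - z r) = (\<lambda>r. (x r - y r) + (y r - z r))"
      by simp
    show ?thesis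
      using assms L2_set_triangle_ineq[of "\<lambda>r. x r - y r" "\<lambda>r. y r - z r" "{..<N}"]
      by (auto simp: lp_dist_def lp_norm_1 lp_norm_2 simp flip: sum.distrib intro!: sum_mono)
  qed
qed

end

theory Submission
  imports Defs "HOL-Probability.Probability" "HOL-Real_Asymp.Real_Asymp"
begin

text \<open>
  The kernel \<open>exp (- \<parallel>z\<parallel>\<^sub>p)\<close> is the Fourier transform of a density \<open>P\<close> on \<open>\<real>\<^sup>N\<close> which decays only
  polynomially: for \<open>p = 2\<close> it is the Cauchy density, a mixture of Gaussians, and for \<open>p = 1\<close> it is a
  product of one-dimensional Cauchy densities. Hence the quadratic form of \<open>tB\<close> at \<open>x\<close> is
  \<open>\<integral> P(\<xi>) \<bar>\<Sum>\<^sub>a x\<^sub>a e\<^bsup>i t a\<xi>\<^esup>\<bar>\<^sup>2 d\<xi>\<close>, and by Cauchy--Schwarz it dominates a multiple of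
  \<open>(\<Sum>\<^sub>a x\<^sub>a h(a))\<^sup>2\<close> for every \<open>h\<close> whose Fourier transform decays fast enough. Taking for \<open>h\<close> a
  bump at one point of \<open>B\<close> gives strict positive definiteness. Taking \<open>h = 1\<close> on a cube of side of
  order \<open>t\<close> containing \<open>tA\<close>, with norm of order \<open>t\<^sup>N\<close>, gives \<open>\<bar>tA\<bar> = O(t\<^sup>N)\<close>.

  For the lower bound, choose one point of \<open>A\<close> in each cell of the grid of mesh \<open>1/t\<close> that meets \<open>A\<close>.
  There are at least \<open>vol(A) t\<^sup>N\<close> of them, and the row sums of their similarity matrix are bounded
  independently of \<open>t\<close>.
\<close>

section \<open>Quadratic forms and weightings\<close>

definition similarity_form :: "('a \<Rightarrow> 'a \<Rightarrow> real) \<Rightarrow> 'a set \<Rightarrow> ('a \<Rightarrow> real) \<Rightarrow> real" where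
  "similarity_form d A x = (\<Sum>a\<in>A. \<Sum>b\<in>A. x a * similarity d a b * x b)"

lemma similarity_form_rows:
  "similarity_form d A x = (\<Sum>a\<in>A. x a * (\<Sum>b\<in>A. similarity d a b * x b))"
  by (simp add: similarity_form_def sum_distrib_left mult.assoc)

lemma finite_positive_definite_altdef:
  "finite_positive_definite d A \<longleftrightarrow>
     finite A \<and> (\<forall>x. (\<exists>a\<in>A. x a \<noteq> 0) \<longrightarrow> similarity_form d A x > 0)"
  by (simp add: finite_positive_definite_def similarity_form_def)

text \<open>Extending a vector on \<open>B\<close> by zero leaves the value of the form
  unchanged.\<close>

lemma finite_positive_definite_subset:
  assumes "finite_positive_definite d A" "B \<subseteq> A"
  shows "finite_positive_definite d B"
proof -
  have fin: "finite A" "finite B"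
    using assms finite_subset by (auto simp: finite_positive_definite_def)
  have "similarity_form d B x > 0" if x: "\<exists>b\<in>B. x b \<noteq> 0" for x
  proof -
    define x' where "x' = (\<lambda>a. if a \<in> B then x a else 0)"
    have "similarity_form d A x' > 0"
      using assms x unfolding finite_positive_definite_altdef by (metis x'_def subsetD)
    also have "similarity_form d A x' = (\<Sum>a\<in>B. \<Sum>b\<in>A. x' a * similarity d a b * x' b)"
      unfolding similarity_form_def
      by (rule sum.mono_neutral_right) (use assms fin in \<open>auto simp: x'_def\<close>)
    also have "\<dots> = (\<Sum>a\<in>B. \<Sum>b\<in>B. x' a * similarity d a b * x' b)"
      by (intro sum.cong refl sum.mono_neutral_right) (use assms fin in \<open>auto simp: x'_def\<close>)
    also have "\<dots> = similarity_form d B x"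
      by (simp add: similarity_form_def x'_def)
    finally show ?thesis .
  qed
  with fin show ?thesis by (simp add: finite_positive_definite_altdef)
qed

text \<open>The induction step is elimination by the Schur complement \<open>D\<close>, which is positive because it
  is a value of the form.\<close>
lemma finite_positive_definite_solvable:
  assumes "finite_positive_definite d A"
  shows "\<exists>w. \<forall>a\<in>A. (\<Sum>b\<in>A. similarity d a b * w b) = y a"
proof -
  have "finite A" using assms by (simp add: finite_positive_definite_def)
  then show ?thesis using assms
  proof (induction A arbitrary: y)
    case empty
    show ?case by simp
  next
    case (insert a F)
    have F: "finite_positive_definite d F"
      using finite_positive_definite_subset[OF insert.prems] by blast
    obtain u where u: "\<forall>c\<in>F. (\<Sum>b\<in>F. similarity d c b * u b) = similarity d c a"
      using insert.IH[OF F, of "\<lambda>c. similarity d c a"] by auto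
    obtain v where v: "\<forall>c\<in>F. (\<Sum>b\<in>F. similarity d c b * v b) = y c"
      using insert.IH[OF F] by blast
    \<comment> \<open>\<open>x\<close> has entry 1 at \<open>a\<close> and is annihilated by every
      row in \<open>F\<close>, so only row \<open>a\<close> contributes to the form at
      \<open>x\<close>.\<close>
    define x where "x = (\<lambda>b. if b = a then 1 else - u b)"
    define D where "D = (\<Sum>b\<in>insert a F. similarity d a b * x b)"
    have split: "(\<Sum>b\<in>insert a F. g b) = g a + (\<Sum>b\<in>F. g b)" for g :: "'a \<Rightarrow> real"
      using insert by simp
    have on_F: "(\<Sum>b\<in>F. similarity d c b * x b) = - (\<Sum>b\<in>F. similarity d c b * u b)" for c
      using insert.hyps by (auto simp: x_def sum_negf[symmetric] intro!: sum.cong)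
    have x0: "(\<Sum>b\<in>insert a F. similarity d c b * x b) = 0" if "c \<in> F" for c
      using u that by (simp add: split on_F) (simp add: x_def)
    have "similarity_form d (insert a F) x = D"
      using x0 by (simp add: similarity_form_rows split[of "\<lambda>a'. x a' * _ a'"] D_def[symmetric])
        (simp add: x_def)
    moreover have "similarity_form d (insert a F) x > 0"
      using insert.prems by (auto simp: finite_positive_definite_altdef x_def)
    ultimately have "D > 0" by simp
    define v' where "v' = (\<lambda>b. if b = a then 0 else v b)"
    have v'_F: "(\<Sum>b\<in>insert a F. similarity d c b * v' b) = (\<Sum>b\<in>F. similarity d c b * v b)" for c
      using insert.hyps by (auto simp: v'_def split intro!: sum.cong)
    \<comment> \<open>Adding multiples of \<open>x\<close> does not disturb the rows in
      \<open>F\<close>, so \<open>k\<close> is free to correct row \<open>a\<close>.\<close>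
    define k where "k = (y a - (\<Sum>b\<in>insert a F. similarity d a b * v' b)) / D"
    define w where "w = (\<lambda>b. v' b + k * x b)"
    have w: "(\<Sum>b\<in>insert a F. similarity d c b * w b)
        = (\<Sum>b\<in>insert a F. similarity d c b * v' b) + k * (\<Sum>b\<in>insert a F. similarity d c b * x b)" for c
      by (simp add: w_def distrib_left sum.distrib sum_distrib_left mult_ac)
    have "(\<Sum>b\<in>insert a F. similarity d c b * w b) = y c" if "c \<in> insert a F" for c
    proof (cases "c = a")
      case True
      have "(\<Sum>b\<in>insert a F. similarity d a b * w b) = (\<Sum>b\<in>insert a F. similarity d a b * v' b) + k * D"
        unfolding D_def by (rule w)
      moreover have "k * D = y a - (\<Sum>b\<in>insert a F. similarity d a b * v' b)"
        unfolding k_def using \<open>D > 0\<close> by (intro nonzero_eq_divide_eq[THEN iffD1] refl) auto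
      ultimately show ?thesis using True by simp
    next
      case False
      then have "c \<in> F" using that by simp
      then show ?thesis unfolding w v'_F x0[OF \<open>c \<in> F\<close>] using v by simp
    qed
    then show ?case by blast
  qed
qed

text \<open>The similarity matrix annihilates the difference of two weightings, so the form vanishes
  there; strict definiteness makes the weighting itself unique and the description in
  \<open>finite_magnitude\<close> proper.\<close>

lemma finite_positive_definite_weighting:
  assumes "finite_positive_definite d A"
  obtains w where "weighting d A w" "finite_magnitude d A = (\<Sum>a\<in>A. w a)"
proof -
  obtain w where w: "weighting d A w"
    using finite_positive_definite_solvable[OF assms, of "\<lambda>_. 1"] by (auto simp: weighting_def)
  have "(\<Sum>a\<in>A. w' a) = (\<Sum>a\<in>A. w a)" if w': "weighting d A w'" for w'
  proof -
    have "similarity_form d A (\<lambda>a. w' a - w a) = 0"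
      using w w' by (simp add: similarity_form_rows weighting_def right_diff_distrib sum_subtractf)
    then have "\<forall>a\<in>A. w' a - w a = 0"
      using assms unfolding finite_positive_definite_altdef by (metis less_irrefl)
    then show ?thesis by (intro sum.cong) auto
  qed
  then have "finite_magnitude d A = (\<Sum>a\<in>A. w a)"
    unfolding finite_magnitude_def using w by (intro the_equality) blast+
  with w show ?thesis by (rule that)
qed

section \<open>Bounds on the magnitude of finite spaces\<close>

lemma similarity_form_weighting:
  assumes "weighting d A w"
  shows "similarity_form d A w = (\<Sum>a\<in>A. w a)"
  using assms by (simp add: similarity_form_rows weighting_def)

text \<open>At the weighting, the sum of the entries and the form both equal the magnitude
  \<open>m\<close>, so the last hypothesis reads \<open>m^2 \<le> D * m\<close>.\<close>

lemma finite_magnitude_le: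
  assumes "finite_positive_definite d A" "D \<ge> 0"
    and "\<And>x. (\<Sum>a\<in>A. x a)\<^sup>2 \<le> D * similarity_form d A x"
  shows "finite_magnitude d A \<le> D"
proof -
  obtain w where w: "weighting d A w" "finite_magnitude d A = (\<Sum>a\<in>A. w a)"
    using finite_positive_definite_weighting[OF assms(1)] .
  have "(finite_magnitude d A)\<^sup>2 \<le> D * finite_magnitude d A"
    using assms(3)[of w] w similarity_form_weighting by metis
  then show ?thesis
    using assms(2) by (cases "finite_magnitude d A > 0") (auto simp: power2_eq_square)
qed

text \<open>The form is evaluated at \<open>1 - K w\<close>, where \<open>w\<close> is the weighting.\<close>
lemma finite_magnitude_ge:
  assumes pd: "finite_positive_definite d A" and K: "K > 0"
    and sym: "\<And>a b. a \<in> A \<Longrightarrow> b \<in> A \<Longrightarrow> d a b = d b a"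
    and rows: "\<And>a. a \<in> A \<Longrightarrow> (\<Sum>b\<in>A. similarity d a b) \<le> K"
  shows "real (card A) / K \<le> finite_magnitude d A"
proof -
  obtain w where w: "weighting d A w" "finite_magnitude d A = (\<Sum>a\<in>A. w a)"
    using finite_positive_definite_weighting[OF pd] .
  have nonneg: "similarity_form d A x \<ge> 0" for x
    using pd unfolding finite_positive_definite_altdef
    by (cases "\<exists>a\<in>A. x a \<noteq> 0") (auto simp: similarity_form_def less_imp_le)
  define v where "v = (\<lambda>a. 1 - K * w a)"
  \<comment> \<open>Exchanging the sums and using symmetry of \<open>d\<close> turns the cross term
    into the weighting equations, each of which contributes 1.\<close>
  have "(\<Sum>a\<in>A. w a * (\<Sum>b\<in>A. similarity d a b)) = (\<Sum>b\<in>A. \<Sum>a\<in>A. w a * similarity d a b)"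
    unfolding sum_distrib_left by (rule sum.swap)
  also have "\<dots> = (\<Sum>b\<in>A. \<Sum>a\<in>A. similarity d b a * w a)"
    using sym by (intro sum.cong refl) (auto simp: similarity_def)
  also have "\<dots> = real (card A)"
    using w by (simp add: weighting_def)
  finally have cross: "(\<Sum>a\<in>A. w a * (\<Sum>b\<in>A. similarity d a b)) = real (card A)" .
  have "0 \<le> similarity_form d A v" by (rule nonneg)
  also have "\<dots> = (\<Sum>a\<in>A. v a * ((\<Sum>b\<in>A. similarity d a b) - K))"
    unfolding similarity_form_rows
  proof (intro sum.cong refl arg_cong2[where f = "(*)"])
    fix a assume "a \<in> A"
    have "(\<Sum>b\<in>A. similarity d a b * v b)
        = (\<Sum>b\<in>A. similarity d a b) - K * (\<Sum>b\<in>A. similarity d a b * w b)"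
      by (simp add: v_def right_diff_distrib sum_subtractf sum_distrib_left mult.left_commute)
    then show "(\<Sum>b\<in>A. similarity d a b * v b) = (\<Sum>b\<in>A. similarity d a b) - K"
      using w(1) \<open>a \<in> A\<close> by (simp add: weighting_def)
  qed
  also have "\<dots> = (\<Sum>a\<in>A. \<Sum>b\<in>A. similarity d a b) - K * real (card A)
      - K * (\<Sum>a\<in>A. w a * (\<Sum>b\<in>A. similarity d a b)) + K^2 * (\<Sum>a\<in>A. w a)"
  proof -
    have "(\<Sum>a\<in>A. v a * (r a - K))
        = (\<Sum>a\<in>A. r a) - K * real (card A) - K * (\<Sum>a\<in>A. w a * r a) + K^2 * (\<Sum>a\<in>A. w a)" for r
    proof -
      have "(\<Sum>a\<in>A. v a * (r a - K)) = (\<Sum>a\<in>A. r a - K - K * (w a * r a) + K^2 * w a)"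
        by (rule sum.cong) (simp_all add: v_def algebra_simps power2_eq_square)
      then show ?thesis
        by (simp add: sum_subtractf sum.distrib flip: sum_distrib_left)
    qed
    then show ?thesis by this
  qed
  also have "\<dots> \<le> K * real (card A) - K * real (card A) - K * real (card A) + K^2 * finite_magnitude d A"
  proof -
    have "(\<Sum>a\<in>A. \<Sum>b\<in>A. similarity d a b) \<le> (\<Sum>a\<in>A. K)" by (rule sum_mono[OF rows])
    then show ?thesis unfolding cross w(2) by (simp add: mult.commute)
  qed
  finally have "K * real (card A) \<le> K * (K * finite_magnitude d A)"
    by (simp add: power2_eq_square)
  then show ?thesis using K by (simp add: field_simps)
qed

section \<open>Fourier representation of the kernels\<close>

text \<open>Near \<open>x\<close> the distribution function is a constant plus the integral of the
  continuous density from \<open>x - 1\<close>, so the fundamental theorem of calculus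
  applies.\<close>

lemma DERIV_cdf_std_normal:
  "DERIV (cdf std_normal_distribution) x :> std_normal_density x"
proof -
  interpret real_distribution std_normal_distribution by (rule real_dist_normal_dist)
  let ?M = "std_normal_distribution"
  have cont: "continuous_on S std_normal_density" for S
    unfolding std_normal_density_def by (intro continuous_intros) auto
  have eq: "cdf ?M (x - 1) + integral {x - 1..y} std_normal_density = cdf ?M y" if "y \<in> {x - 1<..<x + 1}" for y
  proof -
    have "cdf ?M y - cdf ?M (x - 1) = measure ?M {x - 1<..y}"
      using that by (intro cdf_diff_eq) auto
    also have "\<dots> = (LINT u|?M. indicator {x - 1<..y} u)"
      by simp
    also have "\<dots> = (LINT u:{x - 1<..y}|lborel. std_normal_density u)"
      unfolding set_lebesgue_integral_def
      by (subst integral_density) (auto simp: mult.commute)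
    also have "\<dots> = (LINT u:{x - 1..y}|lborel. std_normal_density u)"
      unfolding set_lebesgue_integral_def
      by (rule integral_cong_AE)
        (auto intro!: AE_I[of _ _ "{x - 1}"] simp: indicator_def)
    also have "\<dots> = integral {x - 1..y} std_normal_density"
      by (intro set_borel_integral_eq_integral borel_integrable_atLeastAtMost' cont)
    finally show ?thesis by simp
  qed
  have "((\<lambda>y. integral {x - 1..y} std_normal_density) has_real_derivative std_normal_density x)
      (at x within {x - 1..x + 1})"
    by (intro integral_has_real_derivative cont) auto
  then have "((\<lambda>y. integral {x - 1..y} std_normal_density) has_real_derivative std_normal_density x) (at x)"
    by (simp add: at_within_Icc_at)
  then have "((\<lambda>y. cdf ?M (x - 1) + integral {x - 1..y} std_normal_density)
      has_real_derivative std_normal_density x) (at x)"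
    by (intro derivative_eq_intros) auto
  then show ?thesis
    by (rule has_field_derivative_transform_within_open[where S = "{x - 1<..<x + 1}"]) (use eq in auto)
qed

text \<open>With \<open>c = r/2\<close> and \<open>\<Phi>\<close> the standard normal distribution function, an antiderivative on
  \<open>v > 0\<close> is \<open>exp(-r) \<Phi>(\<surd>2 (v - c/v)) + exp(r) \<Phi>(\<surd>2 (v + c/v))\<close>.\<close>
lemma exp_minus_subordination:
  assumes "r \<ge> 0"
  shows "has_bochner_integral lborel
    (\<lambda>v. indicator {0<..} v * (2 / sqrt pi * exp (- v\<^sup>2) * exp (- (r\<^sup>2 / (4 * v\<^sup>2))))) (exp (- r))"
proof (cases "r = 0")
  case True
  \<comment> \<open>For \<open>r = 0\<close> the arguments of the distribution function in the
    antiderivative stay finite at 0, so the limits taken in the other case fail; the integrand is a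
    half Gaussian.\<close>
  have "has_bochner_integral lborel (\<lambda>v. 2 / sqrt pi * (indicator {0..} v *\<^sub>R exp (- v\<^sup>2))) (2 / sqrt pi * (sqrt pi / 2))"
    by (intro has_bochner_integral_mult_right gaussian_moment_0)
  then have "has_bochner_integral lborel (\<lambda>v. 2 / sqrt pi * (indicator {0..} v *\<^sub>R exp (- v\<^sup>2))) 1"
    by simp
  then show ?thesis
    unfolding True
    by (subst (asm) has_bochner_integral_cong_AE[where g = "\<lambda>v. indicator {0<..} v * (2 / sqrt pi * exp (- v\<^sup>2) * exp (- (0\<^sup>2 / (4 * v\<^sup>2))))"])
      (auto intro!: AE_I[of _ _ "{0}"] simp: indicator_def)
next
  case False
  define c where "c = r / 2"
  have c: "c > 0" and r: "r = 2 * c" using assms False by (auto simp: c_def)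
  interpret real_distribution std_normal_distribution by (rule real_dist_normal_dist)
  let ?\<Phi> = "cdf std_normal_distribution"
  define F where "F v = exp (- r) * ?\<Phi> (sqrt 2 * (v - c / v)) + exp r * ?\<Phi> (sqrt 2 * (v + c / v))" for v
  define f where "f v = 2 / sqrt pi * exp (- v\<^sup>2) * exp (- (r\<^sup>2 / (4 * v\<^sup>2)))" for v
  have normal: "e * (std_normal_density y * (sqrt 2 * k)) = e * exp (- (y\<^sup>2 / 2)) / sqrt pi * k" for e y k
    by (simp add: std_normal_density_def real_sqrt_mult)
  have deriv: "DERIV F v :> f v" if "v > 0" for v
  proof -
    have "DERIV F v :> exp (- r) * (std_normal_density (sqrt 2 * (v - c / v)) * (sqrt 2 * (1 + c / v\<^sup>2)))
       + exp r * (std_normal_density (sqrt 2 * (v + c / v)) * (sqrt 2 * (1 - c / v\<^sup>2)))"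
      unfolding F_def using that
      by (auto intro!: derivative_eq_intros DERIV_chain2[OF DERIV_cdf_std_normal]
          simp: power2_eq_square)
    also have "exp (- r) * (std_normal_density (sqrt 2 * (v - c / v)) * (sqrt 2 * (1 + c / v\<^sup>2)))
       = exp (- v\<^sup>2) * exp (- (r\<^sup>2 / (4 * v\<^sup>2))) / sqrt pi * (1 + c / v\<^sup>2)"
    proof -
      \<comment> \<open>Completing the square:
        \<open>(v - c / v)^2 + 2 * c = v^2 + c^2 / v^2\<close>, where \<open>r = 2 * c\<close>. The
        other sign is treated in the same way.\<close>
      have "- r + - ((sqrt 2 * (v - c / v))\<^sup>2 / 2) = - v\<^sup>2 + - (r\<^sup>2 / (4 * v\<^sup>2))"
        using that by (simp add: power_mult_distrib power2_diff r power_divide diff_divide_distrib add_divide_distrib)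
      then have "exp (- r) * exp (- ((sqrt 2 * (v - c / v))\<^sup>2 / 2)) = exp (- v\<^sup>2) * exp (- (r\<^sup>2 / (4 * v\<^sup>2)))"
        by (simp only: exp_add[symmetric])
      then show ?thesis by (simp only: normal)
    qed
    also have "exp r * (std_normal_density (sqrt 2 * (v + c / v)) * (sqrt 2 * (1 - c / v\<^sup>2)))
       = exp (- v\<^sup>2) * exp (- (r\<^sup>2 / (4 * v\<^sup>2))) / sqrt pi * (1 - c / v\<^sup>2)"
    proof -
      have "r + - ((sqrt 2 * (v + c / v))\<^sup>2 / 2) = - v\<^sup>2 + - (r\<^sup>2 / (4 * v\<^sup>2))"
        using that by (simp add: power_mult_distrib power2_sum r power_divide diff_divide_distrib add_divide_distrib)
      then have "exp r * exp (- ((sqrt 2 * (v + c / v))\<^sup>2 / 2)) = exp (- v\<^sup>2) * exp (- (r\<^sup>2 / (4 * v\<^sup>2)))"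
        by (simp only: exp_add[symmetric])
      then show ?thesis by (simp only: normal)
    qed
    also have "exp (- v\<^sup>2) * exp (- (r\<^sup>2 / (4 * v\<^sup>2))) / sqrt pi * (1 + c / v\<^sup>2)
        + exp (- v\<^sup>2) * exp (- (r\<^sup>2 / (4 * v\<^sup>2))) / sqrt pi * (1 - c / v\<^sup>2) = f v"
      by (simp add: f_def distrib_left right_diff_distrib)
    finally show ?thesis .
  qed
  \<comment> \<open>These limits give \<open>F\<close> the value \<open>exp r\<close> at 0 and
    \<open>exp (- r) + exp r\<close> at infinity; the integral is the difference.\<close>
  have at0: "filterlim (\<lambda>v. sqrt 2 * (v - c / v)) at_bot (at_right 0)"
    "filterlim (\<lambda>v. sqrt 2 * (v + c / v)) at_top (at_right 0)"
    using c by real_asymp+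
  have atI: "filterlim (\<lambda>v. sqrt 2 * (v - c / v)) at_top at_top"
    "filterlim (\<lambda>v. sqrt 2 * (v + c / v)) at_top at_top"
    using c by real_asymp+
  have A: "(F \<longlongrightarrow> exp (- r) * 0 + exp r * 1) (at_right 0)"
    unfolding F_def
    by (intro tendsto_intros filterlim_compose[OF cdf_lim_at_bot at0(1)]
        filterlim_compose[OF cdf_lim_at_top_prob at0(2)])
  have B: "(F \<longlongrightarrow> exp (- r) * 1 + exp r * 1) at_top"
    unfolding F_def
    by (intro tendsto_intros filterlim_compose[OF cdf_lim_at_top_prob atI(1)]
        filterlim_compose[OF cdf_lim_at_top_prob atI(2)])
  have FTC: "set_integrable lborel (einterval 0 \<infinity>) f"
    "(LBINT v=0..\<infinity>. f v) = (exp (- r) * 1 + exp r * 1) - (exp (- r) * 0 + exp r * 1)"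
  proof -
    have 1: "DERIV F v :> f v" if "0 < ereal v" for v using that by (intro deriv) simp
    have 2: "isCont f v" if "0 < ereal v" for v
      using that unfolding f_def by (intro continuous_intros) auto
    have 3: "AE v in lborel. 0 < ereal v \<longrightarrow> ereal v < \<infinity> \<longrightarrow> 0 \<le> f v"
      by (auto simp: f_def)
    have 4: "((F \<circ> real_of_ereal) \<longlongrightarrow> exp (- r) * 0 + exp r * 1) (at_right 0)"
      using A by (simp add: zero_ereal_def ereal_tendsto_simps)
    have 5: "((F \<circ> real_of_ereal) \<longlongrightarrow> exp (- r) * 1 + exp r * 1) (at_left \<infinity>)"
      using B by (simp add: ereal_tendsto_simps)
    show "set_integrable lborel (einterval 0 \<infinity>) f"
      by (rule interval_integral_FTC_nonneg(1)[OF _ 1 2 3 4 5]) auto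
    show "(LBINT v=0..\<infinity>. f v) = (exp (- r) * 1 + exp r * 1) - (exp (- r) * 0 + exp r * 1)"
      by (rule interval_integral_FTC_nonneg(2)[OF _ 1 2 3 4 5]) auto
  qed
  have ei: "einterval 0 \<infinity> = {0<..}"
    by (auto simp: einterval_def)
  show ?thesis
    using FTC unfolding interval_lebesgue_integral_def ei set_lebesgue_integral_def set_integrable_def
    by (simp add: has_bochner_integral_iff f_def mult.assoc)
qed

text \<open>This is the characteristic function of the standard normal distribution after the
  substitution \<open>y = sqrt 2 * v * \<xi>\<close>.\<close>

lemma gaussian_fourier:
  assumes "v > 0"
  shows "has_bochner_integral lborel
    (\<lambda>\<xi>. (v / sqrt pi * exp (- (v\<^sup>2 * \<xi>\<^sup>2))) *\<^sub>R cis (\<xi> * z)) (of_real (exp (- (z\<^sup>2 / (4 * v\<^sup>2)))))"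
proof -
  interpret real_distribution std_normal_distribution by (rule real_dist_normal_dist)
  define t where "t = z / (sqrt 2 * v)"
  have int: "integrable lborel (\<lambda>y. std_normal_density y *\<^sub>R cis (y * t))"
    by (rule Bochner_Integration.integrable_bound[OF integrable_normal_density[where \<mu> = 0 and \<sigma> = 1]])
      (simp_all add: cis_conv_exp)
  have "char std_normal_distribution t = (CLINT y|lborel. std_normal_density y *\<^sub>R cis (y * t))"
    unfolding char_def
    by (subst integral_density) (auto simp: cis_conv_exp mult.commute)
  then have "has_bochner_integral lborel (\<lambda>y. std_normal_density y *\<^sub>R cis (y * t)) (of_real (exp (- t\<^sup>2 / 2)))"
    using int by (simp add: has_bochner_integral_iff char_std_normal_distribution)
  then have "has_bochner_integral lborel
      (\<lambda>\<xi>. std_normal_density (0 + (sqrt 2 * v) * \<xi>) *\<^sub>R cis ((0 + (sqrt 2 * v) * \<xi>) * t))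
      (of_real (exp (- t\<^sup>2 / 2)) /\<^sub>R \<bar>sqrt 2 * v\<bar>)"
    using assms by (subst (asm) lborel_has_bochner_integral_real_affine_iff[where c = "sqrt 2 * v" and t = 0]) auto
  then have "has_bochner_integral lborel
      (\<lambda>\<xi>. (sqrt 2 * v) *\<^sub>R (std_normal_density (0 + (sqrt 2 * v) * \<xi>) *\<^sub>R cis ((0 + (sqrt 2 * v) * \<xi>) * t)))
      ((sqrt 2 * v) *\<^sub>R (of_real (exp (- t\<^sup>2 / 2)) /\<^sub>R \<bar>sqrt 2 * v\<bar>))"
    by (rule has_bochner_integral_scaleR_right)
  also have "(\<lambda>\<xi>. (sqrt 2 * v) *\<^sub>R (std_normal_density (0 + (sqrt 2 * v) * \<xi>) *\<^sub>R cis ((0 + (sqrt 2 * v) * \<xi>) * t)))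
      = (\<lambda>\<xi>. (v / sqrt pi * exp (- (v\<^sup>2 * \<xi>\<^sup>2))) *\<^sub>R cis (\<xi> * z))"
    using assms by (auto simp: std_normal_density_def power_mult_distrib t_def real_sqrt_mult mult.commute)
  also have "(sqrt 2 * v) *\<^sub>R (of_real (exp (- t\<^sup>2 / 2)) /\<^sub>R \<bar>sqrt 2 * v\<bar>)
      = complex_of_real (exp (- (z\<^sup>2 / (4 * v\<^sup>2))))"
  proof -
    have "(sqrt 2 * v) *\<^sub>R (x /\<^sub>R \<bar>sqrt 2 * v\<bar>) = x" for x :: complex
    proof -
      have "sqrt 2 * v * inverse \<bar>sqrt 2 * v\<bar> = 1"
        using assms by (intro right_inverse[THEN trans[rotated]] arg_cong2[where f = "(*)"]) auto
      then show ?thesis by (simp only: scaleR_scaleR scaleR_one)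
    qed
    then show ?thesis by (simp only:) (simp add: t_def power_divide power_mult_distrib)
  qed
  finally show ?thesis .
qed

section \<open>The multivariate Cauchy density\<close>

text \<open>Serves to replace the radial weight \<open>1 + (\<Sum>r<N. (\<xi> r)^2)\<close> by a
  product weight, which integrates coordinate by coordinate.\<close>

lemma one_plus_sum_le_prod:
  fixes f :: "'a \<Rightarrow> real"
  assumes "\<And>i. i \<in> I \<Longrightarrow> f i \<ge> 0"
  shows "1 + (\<Sum>i\<in>I. f i) \<le> (\<Prod>i\<in>I. 1 + f i)"
  using assms
proof (induction I rule: infinite_finite_induct)
  case (insert i I)
  have "1 + (\<Sum>j\<in>insert i I. f j) \<le> (1 + f i) * (1 + (\<Sum>j\<in>I. f j))"
    using insert.hyps insert.prems by (simp add: algebra_simps sum_nonneg)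
  also have "\<dots> \<le> (1 + f i) * (\<Prod>j\<in>I. 1 + f j)"
    using insert by (intro mult_left_mono) auto
  finally show ?case using insert.hyps by simp
qed auto

lemma prod_scaleR:
  fixes c :: "'a \<Rightarrow> 'b::{real_algebra_1,comm_monoid_mult}"
  shows "(\<Prod>i\<in>I. a i *\<^sub>R c i) = (\<Prod>i\<in>I. a i) *\<^sub>R (\<Prod>i\<in>I. c i)"
  by (induction I rule: infinite_finite_induct) auto

text \<open>The mixing weight is the integrand of \<open>exp_minus_subordination\<close> at
  \<open>r = 0\<close>; the factors are the Gaussian densities of
  \<open>gaussian_fourier\<close>.\<close>

definition gauss_mix :: "nat \<Rightarrow> real \<Rightarrow> (nat \<Rightarrow> real) \<Rightarrow> real" where
  "gauss_mix N v \<xi> = indicator {0<..} v * (2 / sqrt pi * exp (- v\<^sup>2) *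
     (\<Prod>r<N. v / sqrt pi * exp (- (v\<^sup>2 * (\<xi> r)\<^sup>2))))"

text \<open>The multivariate Cauchy density, as a mixture of Gaussians.\<close>
definition cauchy_density :: "nat \<Rightarrow> (nat \<Rightarrow> real) \<Rightarrow> real" where
  "cauchy_density N \<xi> = (LBINT v. gauss_mix N v \<xi>)"

lemma gauss_mix_nonneg: "gauss_mix N v \<xi> \<ge> 0"
  by (cases "v > 0") (simp_all add: gauss_mix_def prod_nonneg)

lemma gauss_mix_measurable:
  "(\<lambda>(v, \<xi>). gauss_mix N v \<xi>) \<in> borel_measurable (lborel \<Otimes>\<^sub>M PiM {..<N} (\<lambda>_. lborel))"
  unfolding gauss_mix_def split_beta
  by measurable

lemma gauss_mix_measurable': "(\<lambda>v. gauss_mix N v \<xi>) \<in> borel_measurable lborel"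
  unfolding gauss_mix_def by measurable

lemma gauss_mix_eq:
  "gauss_mix N v \<xi> = indicator {0<..} v *
     (2 / sqrt pi * (v / sqrt pi) ^ N * exp (- (v\<^sup>2 * (1 + (\<Sum>r<N. (\<xi> r)\<^sup>2)))))"
proof -
  have "exp (- v\<^sup>2) * (\<Prod>r<N. v / sqrt pi * exp (- (v\<^sup>2 * (\<xi> r)\<^sup>2)))
      = (v / sqrt pi) ^ N * (exp (- v\<^sup>2) * exp (\<Sum>r<N. - (v\<^sup>2 * (\<xi> r)\<^sup>2)))"
    unfolding prod.distrib exp_sum[OF finite_lessThan] by simp
  also have "exp (- v\<^sup>2) * exp (\<Sum>r<N. - (v\<^sup>2 * (\<xi> r)\<^sup>2)) = exp (- (v\<^sup>2 * (1 + (\<Sum>r<N. (\<xi> r)\<^sup>2))))"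
    unfolding exp_add[symmetric] by (simp add: sum_negf sum_distrib_left distrib_left)
  finally show ?thesis by (simp only: gauss_mix_def mult.assoc)
qed

text \<open>The exponent is at most \<open>- v^2 / 2\<close>, so the integrand is dominated by a
  multiple of the one defining the \<open>N\<close>-th absolute moment of the standard normal
  distribution.\<close>

lemma gauss_mix_integrable: "integrable lborel (\<lambda>v. gauss_mix N v \<xi>)"
proof (rule Bochner_Integration.integrable_bound)
  show "integrable lborel (\<lambda>v. (2 / sqrt pi * (1 / sqrt pi) ^ N * sqrt (2 * pi)) * (std_normal_density v * \<bar>v\<bar> ^ N))"
    by (intro integrable_mult_right integrable_std_normal_moment_abs)
  show "AE v in lborel. norm (gauss_mix N v \<xi>) \<le>
    norm ((2 / sqrt pi * (1 / sqrt pi) ^ N * sqrt (2 * pi)) * (std_normal_density v * \<bar>v\<bar> ^ N))"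
  proof (rule AE_I2)
    fix v :: real
    have "v\<^sup>2 * (1 + (\<Sum>r<N. (\<xi> r)\<^sup>2)) \<ge> v\<^sup>2 * (1 / 2)"
      by (intro mult_left_mono) (auto intro!: add_increasing2 sum_nonneg)
    then have "exp (- (v\<^sup>2 * (1 + (\<Sum>r<N. (\<xi> r)\<^sup>2)))) \<le> exp (- v\<^sup>2 / 2)"
      by simp
    then have "norm (gauss_mix N v \<xi>) \<le> 2 / sqrt pi * (\<bar>v\<bar> / sqrt pi) ^ N * exp (- v\<^sup>2 / 2)"
    proof (cases "v > 0")
      case False
      then have "gauss_mix N v \<xi> = 0" by (simp add: gauss_mix_def)
      moreover have "0 \<le> 2 / sqrt pi * (\<bar>v\<bar> / sqrt pi) ^ N * exp (- v\<^sup>2 / 2)"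
        by (intro mult_nonneg_nonneg zero_le_power divide_nonneg_nonneg) auto
      ultimately show ?thesis by (simp only: norm_zero)
    qed (auto simp: gauss_mix_eq intro!: divide_right_mono mult_left_mono)
    also have "\<dots> = (2 / sqrt pi * (1 / sqrt pi) ^ N * sqrt (2 * pi)) * (std_normal_density v * \<bar>v\<bar> ^ N)"
      by (simp add: std_normal_density_def power_divide)
    finally show "norm (gauss_mix N v \<xi>) \<le>
      norm ((2 / sqrt pi * (1 / sqrt pi) ^ N * sqrt (2 * pi)) * (std_normal_density v * \<bar>v\<bar> ^ N))"
      by simp
  qed
qed (use gauss_mix_measurable' in auto)

text \<open>Only \<open>v\<close> of order \<open>1 / S\<close> is kept, where
  \<open>S = 1 + (\<Sum>r<N. (\<xi> r)^2)\<close>. This yields the power \<open>N + 1\<close> of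
  \<open>S\<close> rather than the true \<open>(N + 1) / 2\<close>, but any polynomial rate
  suffices, since bumps exist for every exponent.\<close>

lemma cauchy_density_lower:
  "\<exists>c>0. \<forall>\<xi>. c / (\<Prod>r<N. 1 + (\<xi> r)\<^sup>2) ^ Suc N \<le> cauchy_density N \<xi>"
proof -
  \<comment> \<open>For \<open>v\<close> between \<open>u / 2\<close> and \<open>u\<close> the
    mixture is at least \<open>2 * c * u ^ N\<close>; the last factor \<open>1 / 2\<close> accounts
    for the length \<open>u / 2\<close> of this interval.\<close>
  define c where "c = 2 / sqrt pi * (1 / (2 * sqrt pi)) ^ N * exp (- 1) / 2"
  have c: "c > 0" by (simp add: c_def)
  have "c / (\<Prod>r<N. 1 + (\<xi> r)\<^sup>2) ^ Suc N \<le> cauchy_density N \<xi>" for \<xi>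
  proof -
    define S where "S = 1 + (\<Sum>r<N. (\<xi> r)\<^sup>2)"
    have S: "S \<ge> 1" by (simp add: S_def sum_nonneg)
    define u where "u = 1 / S"
    have u: "0 < u" "u \<le> 1" using S by (auto simp: u_def)
    have SP: "S \<le> (\<Prod>r<N. 1 + (\<xi> r)\<^sup>2)"
      unfolding S_def by (rule one_plus_sum_le_prod) auto
    have bound: "indicator {u / 2..u} v * (2 * c * u ^ N) \<le> gauss_mix N v \<xi>" for v
    proof (cases "v \<in> {u / 2..u}")
      case True
      have "v\<^sup>2 * S \<le> u\<^sup>2 * S"
        using True u S by (intro mult_right_mono power_mono) auto
      also have "\<dots> = u" using S by (simp add: u_def power2_eq_square)
      finally have "exp (- 1) \<le> exp (- (v\<^sup>2 * S))" using u by simp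
      moreover have "(u / 2 / sqrt pi) ^ N \<le> (v / sqrt pi) ^ N"
        using True u by (intro power_mono divide_right_mono) auto
      ultimately have "(u / 2 / sqrt pi) ^ N * exp (- 1) \<le> (v / sqrt pi) ^ N * exp (- (v\<^sup>2 * S))"
        using True u by (intro mult_mono) auto
      then have "2 / sqrt pi * ((u / 2 / sqrt pi) ^ N * exp (- 1)) \<le> 2 / sqrt pi * ((v / sqrt pi) ^ N * exp (- (v\<^sup>2 * S)))"
        by (intro mult_left_mono) auto
      moreover have "2 * c * u ^ N = 2 / sqrt pi * ((u / 2 / sqrt pi) ^ N * exp (- 1))"
        by (simp add: c_def power_divide power_mult_distrib)
      ultimately show ?thesis using True u by (simp add: gauss_mix_eq S_def[symmetric])
    qed (use gauss_mix_nonneg in auto)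
    have "c / (\<Prod>r<N. 1 + (\<xi> r)\<^sup>2) ^ Suc N \<le> c / S ^ Suc N"
      using SP S c by (intro divide_left_mono power_mono mult_pos_pos zero_less_power) auto
    also have "\<dots> = (LBINT v. indicator {u / 2..u} v * (2 * c * u ^ N))"
    proof -
      have "(LBINT v. indicator {u / 2..u} v * (2 * c * u ^ N)) = u / 2 * (2 * c * u ^ N)"
        using u by simp
      also have "\<dots> = c * u ^ Suc N" by simp
      finally show ?thesis by (simp add: u_def power_divide)
    qed
    also have "\<dots> \<le> cauchy_density N \<xi>"
      unfolding cauchy_density_def
      using u by (intro integral_mono gauss_mix_integrable bound integrable_mult_left integrable_real_indicator) auto
    finally show ?thesis .
  qed
  with c show ?thesis by blast
qed

text \<open>By Fubini the integral over \<xi> may be taken first. It gives the Gaussian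
  \<open>exp (- \<parallel>z\<parallel>^2 / (4 * v^2))\<close> times the mixing weight, and
  subordination integrates this over \<open>v\<close> to
  \<open>exp (- \<parallel>z\<parallel>)\<close>.\<close>

lemma cauchy_density_fourier:
  fixes z :: "nat \<Rightarrow> real" and N :: nat
  defines "M \<equiv> PiM {..<N} (\<lambda>_. lborel :: real measure)"
  shows "has_bochner_integral M (\<lambda>\<xi>. cauchy_density N \<xi> *\<^sub>R (\<Prod>r<N. cis (\<xi> r * z r)))
    (of_real (exp (- L2_set z {..<N})))"
proof -
  interpret product_sigma_finite "\<lambda>_. lborel :: real measure" ..
  interpret finite_product_sigma_finite "\<lambda>_. lborel :: real measure" "{..<N}" by standard auto
  interpret M: sigma_finite_measure M
    unfolding M_def by (rule sigma_finite_measure_axioms)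
  interpret P: pair_sigma_finite "lborel :: real measure" M ..
  define w where "w v = indicator {0<..} v * (2 / sqrt pi * exp (- v\<^sup>2))" for v :: real
  have w_nonneg: "w v \<ge> 0" for v by (simp add: w_def)
  \<comment> \<open>\<open>H\<close> and \<open>G\<close> are the same integrand: \<open>H\<close>
    exhibits the mixture, \<open>G\<close> is a product over the coordinates.\<close>
  define H where "H v \<xi> = gauss_mix N v \<xi> *\<^sub>R (\<Prod>r<N. cis (\<xi> r * z r))" for v \<xi>
  define G where "G v \<xi> = w v *\<^sub>R (\<Prod>r<N. (v / sqrt pi * exp (- (v\<^sup>2 * (\<xi> r)\<^sup>2))) *\<^sub>R cis (\<xi> r * z r))" for v \<xi>
  have HG: "H v \<xi> = G v \<xi>" for v \<xi>
    by (simp only: H_def G_def w_def gauss_mix_def prod_scaleR scaleR_scaleR mult.assoc)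
  have w_0: "w v = 0" if "v \<le> 0" for v using that by (simp add: w_def)
  have gauss: "has_bochner_integral M
      (\<lambda>\<xi>. \<Prod>r<N. (v / sqrt pi * exp (- (v\<^sup>2 * (\<xi> r)\<^sup>2))) *\<^sub>R cis (\<xi> r * y r))
      (of_real (exp (- ((\<Sum>r<N. (y r)\<^sup>2) / (4 * v\<^sup>2)))))" if "v > 0" for v and y :: "nat \<Rightarrow> real"
  proof -
    let ?g = "\<lambda>r \<xi>. (v / sqrt pi * exp (- (v\<^sup>2 * \<xi>\<^sup>2))) *\<^sub>R cis (\<xi> * y r)"
    have g: "integrable lborel (?g r)" "(LBINT \<xi>. ?g r \<xi>) = of_real (exp (- ((y r)\<^sup>2 / (4 * v\<^sup>2))))" for r
      using gaussian_fourier[OF that, of "y r"] by (simp_all add: has_bochner_integral_iff)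
    have "integrable M (\<lambda>\<xi>. \<Prod>r<N. ?g r (\<xi> r))"
      unfolding M_def by (rule product_integrable_prod) (use g in auto)
    moreover have "integral\<^sup>L M (\<lambda>\<xi>. \<Prod>r<N. ?g r (\<xi> r)) = (\<Prod>r<N. of_real (exp (- ((y r)\<^sup>2 / (4 * v\<^sup>2)))))"
      unfolding M_def by (subst product_integral_prod) (use g in auto)
    moreover have "(\<Prod>r<N. complex_of_real (exp (- ((y r)\<^sup>2 / (4 * v\<^sup>2))))) = of_real (exp (- ((\<Sum>r<N. (y r)\<^sup>2) / (4 * v\<^sup>2))))"
      by (simp flip: of_real_prod exp_sum add: sum_negf sum_divide_distrib)
    ultimately show ?thesis by (simp add: has_bochner_integral_iff)
  qed
  have G_int: "has_bochner_integral M (G v) (w v *\<^sub>R of_real (exp (- ((\<Sum>r<N. (z r)\<^sup>2) / (4 * v\<^sup>2)))))" for v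
  proof (cases "v > 0")
    case True
    then show ?thesis unfolding G_def by (intro has_bochner_integral_scaleR_right gauss)
  qed (simp add: G_def[abs_def] w_0 has_bochner_integral_zero)
  \<comment> \<open>The norm is the integrand at frequency \<open>0\<close>, and a product of
    Gaussian densities has total mass 1. This supplies the absolute integrability for
    Fubini.\<close>
  have N_int: "(\<integral>\<xi>. norm (H v \<xi>) \<partial>M) = w v" for v
  proof (cases "v > 0")
    case True
    have "has_bochner_integral M (\<lambda>\<xi>. Re (w v *\<^sub>R (\<Prod>r<N. (v / sqrt pi * exp (- (v\<^sup>2 * (\<xi> r)\<^sup>2))) *\<^sub>R cis (\<xi> r * 0))))
      (Re (w v *\<^sub>R of_real (exp (- ((\<Sum>r<N. 0\<^sup>2) / (4 * v\<^sup>2))))))"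
      by (intro has_bochner_integral_Re has_bochner_integral_scaleR_right gauss[OF True, of "\<lambda>_. 0"])
    moreover have "Re (w v *\<^sub>R (\<Prod>r<N. (v / sqrt pi * exp (- (v\<^sup>2 * (\<xi> r)\<^sup>2))) *\<^sub>R cis (\<xi> r * 0))) = norm (H v \<xi>)" for \<xi>
    proof -
      have "Re (w v *\<^sub>R (\<Prod>r<N. (v / sqrt pi * exp (- (v\<^sup>2 * (\<xi> r)\<^sup>2))) *\<^sub>R cis (\<xi> r * 0))) = gauss_mix N v \<xi>"
        by (simp only: prod_scaleR gauss_mix_def w_def) simp
      also have "\<dots> = norm (H v \<xi>)"
        by (simp add: H_def gauss_mix_nonneg flip: prod_norm)
      finally show ?thesis .
    qed
    ultimately have "has_bochner_integral M (\<lambda>\<xi>. norm (H v \<xi>))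
      (Re (w v *\<^sub>R of_real (exp (- ((\<Sum>r<N. 0\<^sup>2) / (4 * v\<^sup>2))))))"
      by (simp only:)
    then show ?thesis by (simp add: has_bochner_integral_iff)
  qed (simp add: HG G_def w_0)
  have meas: "case_prod H \<in> borel_measurable (lborel \<Otimes>\<^sub>M M)"
    unfolding H_def M_def split_beta cis_conv_exp
    using gauss_mix_measurable[of N] unfolding split_beta by measurable
  have w_int: "integrable lborel w"
    using integrable.intros[OF exp_minus_subordination[of 0]] by (simp add: w_def[abs_def])
  have H_int: "integrable (lborel \<Otimes>\<^sub>M M) (case_prod H)"
  proof (rule P.Fubini_integrable[OF meas])
    show "integrable lborel (\<lambda>v. \<integral>\<xi>. norm (case_prod H (v, \<xi>)) \<partial>M)"
      by (simp add: N_int w_int)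
    show "AE v in lborel. integrable M (\<lambda>\<xi>. case_prod H (v, \<xi>))"
      using G_int by (simp add: HG has_bochner_integral_iff)
  qed
  have inner: "(LBINT v. H v \<xi>) = cauchy_density N \<xi> *\<^sub>R (\<Prod>r<N. cis (\<xi> r * z r))" for \<xi>
    unfolding H_def cauchy_density_def by (rule integral_scaleR_left[OF gauss_mix_integrable])
  have "integrable M (\<lambda>\<xi>. LBINT v. H v \<xi>)"
    using P.integrable_snd[OF H_int] by simp
  moreover have "(\<integral>\<xi>. (LBINT v. H v \<xi>) \<partial>M) = of_real (exp (- L2_set z {..<N}))"
  proof -
    have "(\<integral>\<xi>. (LBINT v. H v \<xi>) \<partial>M) = (LBINT v. (\<integral>\<xi>. H v \<xi> \<partial>M))"
    by (rule P.Fubini_integral[OF H_int])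
  also have "\<dots> = (LBINT v. complex_of_real (w v * exp (- ((\<Sum>r<N. (z r)\<^sup>2) / (4 * v\<^sup>2)))))"
    using G_int by (intro Bochner_Integration.integral_cong refl) (simp add: HG[abs_def] has_bochner_integral_iff scaleR_conv_of_real)
  also have "\<dots> = of_real (exp (- L2_set z {..<N}))"
  proof -
    have "(LBINT v. w v * exp (- ((\<Sum>r<N. (z r)\<^sup>2) / (4 * v\<^sup>2)))) = exp (- L2_set z {..<N})"
      using has_bochner_integral_integral_eq[OF exp_minus_subordination[of "L2_set z {..<N}"]]
      by (simp add: w_def mult.assoc L2_set_def sum_nonneg)
    then show ?thesis by (simp only: integral_complex_of_real)
  qed
    finally show ?thesis .
  qed
  ultimately show ?thesis by (simp add: inner has_bochner_integral_iff)
qed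

text \<open>The case \<open>N = 1\<close>, carried from the product measure over a single index to
  the line, where it can serve as a coordinate factor.\<close>

lemma cauchy_density_1_fourier:
  "has_bochner_integral lborel (\<lambda>x. cauchy_density 1 (\<lambda>_. x) *\<^sub>R cis (x * y)) (of_real (exp (- \<bar>y\<bar>)))"
proof -
  interpret product_sigma_finite "\<lambda>_::nat. lborel :: real measure" ..
  have [measurable]: "(\<lambda>x. cauchy_density 1 (\<lambda>_. x)) \<in> borel_measurable borel"
    unfolding cauchy_density_def gauss_mix_def by measurable
  have dep: "cauchy_density 1 \<xi> = cauchy_density 1 (\<lambda>_. \<xi> 0)" for \<xi>
    by (simp add: cauchy_density_def gauss_mix_def)
  have "has_bochner_integral (PiM {..<1::nat} (\<lambda>_. lborel)) (\<lambda>\<xi>. cauchy_density 1 (\<lambda>_. \<xi> 0) *\<^sub>R cis (\<xi> 0 * y))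
      (of_real (exp (- L2_set (\<lambda>_. y) {..<1::nat})))"
    by (rule has_bochner_integral_cong[THEN iffD1, OF refl _ refl cauchy_density_fourier[of 1 "\<lambda>_. y"]])
      (subst dep, simp)
  then have "has_bochner_integral (PiM {0::nat} (\<lambda>_. lborel)) (\<lambda>\<xi>. cauchy_density 1 (\<lambda>_. \<xi> 0) *\<^sub>R cis (\<xi> 0 * y))
      (of_real (exp (- \<bar>y\<bar>)))"
    by (simp add: lessThan_Suc L2_set_def)
  then have "has_bochner_integral (distr (PiM {0::nat} (\<lambda>_. lborel)) lborel (\<lambda>\<xi>. \<xi> 0))
      (\<lambda>x. cauchy_density 1 (\<lambda>_. x) *\<^sub>R cis (x * y)) (of_real (exp (- \<bar>y\<bar>)))"
    unfolding cis_conv_exp by (intro has_bochner_integral_distr) measurable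
  then show ?thesis
    by (simp add: distr_singleton)
qed

text \<open>For \<open>p = 2\<close>, \<open>P\<close> is the Cauchy density. For
  \<open>p = 1\<close> the norm is additive over coordinates, so the kernel factors and
  \<open>P\<close> is a product of one-dimensional densities. The product form of the lower bound
  lets the rest treat both cases together.\<close>

lemma lp_kernel_fourier:
  assumes "p \<in> {1, 2}"
  obtains P c n where "c > 0" "\<And>\<xi>. c / (\<Prod>r<N. 1 + (\<xi> r)\<^sup>2) ^ n \<le> P \<xi>"
    "\<And>z. has_bochner_integral (PiM {..<N} (\<lambda>_. lborel)) (\<lambda>\<xi>. P \<xi> *\<^sub>R (\<Prod>r<N. cis (\<xi> r * z r)))
       (of_real (exp (- lp_norm p N z)))"
proof (cases "p = 2")
  case True
  obtain c where "c > 0" "\<And>\<xi>. c / (\<Prod>r<N. 1 + (\<xi> r)\<^sup>2) ^ Suc N \<le> cauchy_density N \<xi>"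
    using cauchy_density_lower by blast
  then show ?thesis
    by (rule that) (use cauchy_density_fourier True in \<open>auto simp: lp_norm_2\<close>)
next
  case False
  then have p: "p = 1" using assms by simp
  interpret product_sigma_finite "\<lambda>_::nat. lborel :: real measure" ..
  define P where "P \<xi> = (\<Prod>r<N. cauchy_density 1 (\<lambda>_. \<xi> r))" for \<xi> :: "nat \<Rightarrow> real"
  obtain c where c: "c > 0" "\<And>\<xi>. c / (\<Prod>r<1::nat. 1 + (\<xi> r)\<^sup>2) ^ Suc 1 \<le> cauchy_density 1 \<xi>"
    using cauchy_density_lower by blast
  have "c ^ N / (\<Prod>r<N. 1 + (\<xi> r)\<^sup>2) ^ 2 \<le> P \<xi>" for \<xi>
  proof -
    have "c ^ N / (\<Prod>r<N. 1 + (\<xi> r)\<^sup>2) ^ 2 = (\<Prod>r<N. c / (1 + (\<xi> r)\<^sup>2) ^ 2)"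
      by (simp add: prod_dividef prod_power_distrib)
    also have "\<dots> \<le> P \<xi>"
      unfolding P_def using c(2)[of "\<lambda>_. \<xi> _"] c(1)
      by (intro prod_mono conjI) (auto simp: lessThan_Suc numeral_2_eq_2)
    finally show ?thesis .
  qed
  moreover have "c ^ N > 0" using c by simp
  moreover have fourier: "has_bochner_integral (PiM {..<N} (\<lambda>_. lborel)) (\<lambda>\<xi>. P \<xi> *\<^sub>R (\<Prod>r<N. cis (\<xi> r * z r)))
       (of_real (exp (- lp_norm p N z)))" for z
  proof -
    let ?g = "\<lambda>r x. cauchy_density 1 (\<lambda>_. x) *\<^sub>R cis (x * z r)"
    have g: "integrable lborel (?g r)" "(LBINT x. ?g r x) = of_real (exp (- \<bar>z r\<bar>))" for r
      using cauchy_density_1_fourier[of "z r"] by (simp_all add: has_bochner_integral_iff)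
    have "integrable (PiM {..<N} (\<lambda>_. lborel)) (\<lambda>\<xi>. \<Prod>r<N. ?g r (\<xi> r))"
      by (rule product_integrable_prod) (use g in auto)
    moreover have "(\<integral>\<xi>. (\<Prod>r<N. ?g r (\<xi> r)) \<partial>PiM {..<N} (\<lambda>_. lborel)) = (\<Prod>r<N. of_real (exp (- \<bar>z r\<bar>)))"
      by (subst product_integral_prod) (use g in auto)
    moreover have "(\<Prod>r<N. complex_of_real (exp (- \<bar>z r\<bar>))) = of_real (exp (- lp_norm p N z))"
      by (simp flip: of_real_prod exp_sum add: sum_negf lp_norm_1 p)
    ultimately show ?thesis
      by (simp add: has_bochner_integral_iff P_def prod_scaleR)
  qed
  ultimately show ?thesis by (intro that[where P = P and n = 2]) auto
qed

section \<open>Bumps with rapidly decaying Fourier transform\<close>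

text \<open>The witness is the distribution of a sum of \<open>2n + 2\<close> independent uniform variables.\<close>
lemma ex_smooth_distribution:
  assumes "\<delta> > 0"
  shows "\<exists>M K. real_distribution M \<and> measure M {-\<delta>..\<delta>} = 1 \<and> K > 0 \<and>
    (\<forall>t. norm (char M t) * (1 + t\<^sup>2) ^ n \<le> K)"
proof -
  \<comment> \<open>An even number of summands lets the characteristic functions pair up, each pair
    paying for one factor \<open>1 + t^2\<close>. \<open>Suc n\<close> keeps \<open>m\<close>, and
    with it \<eta>, positive for \<open>n = 0\<close>.\<close>
  define m where "m = 2 * Suc n"
  define \<eta> where "\<eta> = \<delta> / real m"
  have \<eta>: "\<eta> > 0" using assms by (simp add: \<eta>_def m_def)
  define U where "U = density lborel (\<lambda>x. ennreal (indicator {-\<eta>..\<eta>} x / (2 * \<eta>)))"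
  have [measurable_cong, simp]: "sets U = sets borel"
    by (simp add: U_def)
  have "emeasure U (space U) = (\<integral>\<^sup>+x. ennreal (1 / (2 * \<eta>)) * indicator {-\<eta>..\<eta>} x \<partial>lborel)"
    unfolding U_def by (subst emeasure_density) (auto intro!: nn_integral_cong simp: indicator_def)
  also have "\<dots> = 1"
    using \<eta> by (subst nn_integral_cmult_indicator) (auto simp: ennreal_mult[symmetric])
  finally have pU: "prob_space U" by (intro prob_spaceI)
  have AEU: "AE x in U. \<bar>x\<bar> \<le> \<eta>"
    unfolding U_def by (subst AE_density) (auto simp: indicator_def split: if_splits)
  have charU: "char U t = (CLBINT x=-\<eta>..\<eta>. iexp (t * x)) / (2 * \<eta>)" for t
  proof -
    have "char U t = (CLBINT x. (indicator {-\<eta>..\<eta>} x / (2 * \<eta>)) *\<^sub>R iexp (t * x))"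
      unfolding char_def U_def using \<eta> by (subst integral_density) auto
    also have "\<dots> = (CLBINT x. (indicator {-\<eta>..\<eta>} x *\<^sub>R iexp (t * x)) / (2 * \<eta>))"
      by (intro Bochner_Integration.integral_cong refl) (simp add: scaleR_conv_of_real)
    also have "\<dots> = (CLBINT x:{-\<eta>..\<eta>}. iexp (t * x)) / (2 * \<eta>)"
      by (simp add: set_lebesgue_integral_def)
    also have "(CLBINT x:{-\<eta>..\<eta>}. iexp (t * x)) = (CLBINT x=-\<eta>..\<eta>. iexp (t * x))"
      using \<eta> interval_integral_Icc[of "-\<eta>" \<eta> "\<lambda>x. iexp (t * x)"] by simp
    finally show ?thesis .
  qed
  have U_real: "real_distribution U"
    using pU by (simp add: real_distribution_def real_distribution_axioms_def)
  have charU_le: "norm (char U t) * \<bar>\<eta> * t\<bar> \<le> 1" for t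
  proof (cases "t = 0")
    case False
    have "(CLBINT x=-\<eta>..\<eta>. iexp (t * x)) = iexp (t * \<eta>) / (\<i> * t) - iexp (t * (- \<eta>)) / (\<i> * t)"
    proof (rule interval_integral_FTC_finite)
      show "continuous_on {min (- \<eta>) \<eta>..max (- \<eta>) \<eta>} (\<lambda>x. iexp (t * x))"
        by (intro continuous_intros)
      show "((\<lambda>x. iexp (t * x) / (\<i> * t)) has_vector_derivative iexp (t * x)) (at x within S)" for x S
        using False by (auto intro!: derivative_eq_intros simp: has_vector_derivative_complex_iff Re_exp Im_exp Re_divide Im_divide power2_eq_square)
    qed
    then have "norm (CLBINT x=-\<eta>..\<eta>. iexp (t * x)) \<le> 1 / \<bar>t\<bar> + 1 / \<bar>t\<bar>"
      using norm_triangle_ineq4[of "iexp (t * \<eta>) / (\<i> * t)" "iexp (t * (- \<eta>)) / (\<i> * t)"]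
      by (simp add: norm_divide norm_mult)
    then show ?thesis
      using False \<eta> by (simp add: charU norm_divide norm_mult abs_mult field_simps)
  qed simp
  have charU_sq: "(norm (char U t))\<^sup>2 * (1 + (\<eta> * t)\<^sup>2) \<le> 2" for t
  proof -
    have "(norm (char U t))\<^sup>2 \<le> 1"
      using real_distribution.cmod_char_le_1[OF U_real] by (simp add: power_le_one)
    moreover have "(norm (char U t))\<^sup>2 * (\<eta> * t)\<^sup>2 \<le> 1"
      using charU_le[of t] by (metis abs_ge_zero mult_nonneg_nonneg norm_ge_zero power2_abs power_le_one power_mult_distrib)
    ultimately show ?thesis by (simp add: distrib_left)
  qed
  define k where "k = 2 * (1 + 1 / \<eta>\<^sup>2)"
  have k: "k > 0" by (simp add: k_def add_pos_nonneg)
  have charU_k: "(norm (char U t))\<^sup>2 * (1 + t\<^sup>2) \<le> k" for t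
  proof -
    have "1 + t\<^sup>2 \<le> (1 + 1 / \<eta>\<^sup>2) * (1 + (\<eta> * t)\<^sup>2)"
      using \<eta> by (simp add: field_simps power_mult_distrib)
    then have "(norm (char U t))\<^sup>2 * (1 + t\<^sup>2) \<le> (norm (char U t))\<^sup>2 * ((1 + 1 / \<eta>\<^sup>2) * (1 + (\<eta> * t)\<^sup>2))"
      by (intro mult_left_mono) auto
    also have "\<dots> = (1 + 1 / \<eta>\<^sup>2) * ((norm (char U t))\<^sup>2 * (1 + (\<eta> * t)\<^sup>2))" by (simp add: mult_ac)
    also have "\<dots> \<le> (1 + 1 / \<eta>\<^sup>2) * 2"
      by (intro mult_left_mono charU_sq) auto
    finally show ?thesis by (simp add: k_def)
  qed
  interpret U: prob_space U by (rule pU)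
  interpret product_prob_space "\<lambda>_::nat. U" "{..<m}" ..
  define S where "S = PiM {..<m} (\<lambda>_. U)"
  interpret S: prob_space S unfolding S_def by (intro prob_space_PiM pU)
  have sum_meas [measurable]: "(\<lambda>x. \<Sum>i<m. x i) \<in> borel_measurable S"
    unfolding S_def by measurable
  define M where "M = distr S borel (\<lambda>x. \<Sum>i<m. x i)"
  have M: "real_distribution M"
    unfolding M_def by (rule S.real_distribution_distr) measurable
  interpret M: real_distribution M by (rule M)
  have "AE x in S. \<forall>i\<in>{..<m}. \<bar>x i\<bar> \<le> \<eta>"
  proof (rule AE_finite_allI)
    fix i assume i: "i \<in> {..<m}"
    have "AE y in distr S U (\<lambda>x. x i). \<bar>y\<bar> \<le> \<eta>"
      unfolding S_def PiM_component[OF i] by (rule AEU)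
    then show "AE x in S. \<bar>x i\<bar> \<le> \<eta>"
      by (subst (asm) AE_distr_iff) (use i in \<open>auto simp: S_def\<close>)
  qed simp
  then have "AE x in S. (\<Sum>i<m. x i) \<in> {-\<delta>..\<delta>}"
  proof (rule AE_mp, intro AE_I2 impI)
    fix x :: "nat \<Rightarrow> real" assume x: "\<forall>i\<in>{..<m}. \<bar>x i\<bar> \<le> \<eta>"
    have "\<bar>\<Sum>i<m. x i\<bar> \<le> (\<Sum>i<m. \<bar>x i\<bar>)" by (rule sum_abs)
    also have "\<dots> \<le> (\<Sum>i<m. \<eta>)" using x by (intro sum_mono) auto
    also have "\<dots> = \<delta>" by (simp add: \<eta>_def m_def)
    finally show "(\<Sum>i<m. x i) \<in> {-\<delta>..\<delta>}" by auto
  qed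
  then have "AE y in M. y \<in> {-\<delta>..\<delta>}"
    unfolding M_def by (subst AE_distr_iff) auto
  then have "measure M {-\<delta>..\<delta>} = 1"
    by (subst M.prob_eq_1) auto
  moreover have "norm (char M t) * (1 + t\<^sup>2) ^ n \<le> k ^ Suc n" for t
  proof -
    have "char M t = (CLINT x|S. (\<Prod>i<m. iexp (t * x i)))"
      unfolding M_def char_def
      by (subst integral_distr) (auto simp: sum_distrib_left simp flip: exp_sum intro!: Bochner_Integration.integral_cong)
    also have "\<dots> = (\<Prod>i<m. CLINT y|U. iexp (t * y))"
      unfolding S_def by (rule product_integral_prod) (auto intro: U.integrable_iexp)
    also have "\<dots> = char U t ^ m" by (simp add: char_def)
    finally have "norm (char M t) = ((norm (char U t))\<^sup>2) ^ Suc n"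
      by (simp only: norm_power m_def power_mult)
    then have "norm (char M t) * (1 + t\<^sup>2) ^ n \<le> ((norm (char U t))\<^sup>2) ^ Suc n * (1 + t\<^sup>2) ^ Suc n"
      by (simp only:) (intro mult_left_mono power_increasing zero_le_power zero_le_power2, auto)
    also have "\<dots> = ((norm (char U t))\<^sup>2 * (1 + t\<^sup>2)) ^ Suc n" by (simp only: power_mult_distrib)
    also have "\<dots> \<le> k ^ Suc n" by (intro power_mono charU_k) auto
    finally show ?thesis .
  qed
  ultimately show ?thesis using M k by (metis zero_less_power)
qed

text \<open>\<open>g\<close> represents a bump with plateau
  \<open>\<bar>s\<bar> < \<rho> - \<delta>\<close> that vanishes for
  \<open>\<bar>s\<bar> > \<rho> + \<delta>\<close>. \<open>E\<close> bounds its energy in the norm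
  dual to one coordinate of the weight in \<open>lp_kernel_fourier\<close>.\<close>

definition bump_transform :: "nat \<Rightarrow> real \<Rightarrow> real \<Rightarrow> real \<Rightarrow> (real \<Rightarrow> complex) \<Rightarrow> bool" where
  "bump_transform n \<delta> \<rho> E g \<longleftrightarrow> integrable lborel g \<and>
     integrable lborel (\<lambda>\<xi>. (norm (g \<xi>))\<^sup>2 * (1 + \<xi>\<^sup>2) ^ n) \<and>
     (LBINT \<xi>. (norm (g \<xi>))\<^sup>2 * (1 + \<xi>\<^sup>2) ^ n) \<le> E \<and>
     (\<forall>s. \<bar>s\<bar> < \<rho> - \<delta> \<longrightarrow> (CLBINT \<xi>. g \<xi> * cis (\<xi> * s)) = 1) \<and>
     (\<forall>s. \<bar>s\<bar> > \<rho> + \<delta> \<longrightarrow> (CLBINT \<xi>. g \<xi> * cis (\<xi> * s)) = 0)"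

text \<open>\<open>h(s) = \<mu>((-s-\<rho>, -s+\<rho>])\<close> for a distribution \<open>\<mu>\<close> on \<open>[-\<delta>, \<delta>]\<close> is a trapezoid-like bump, whose
  Fourier representation is read off from the inversion formula for the characteristic function.\<close>
lemma ex_bump:
  assumes "\<delta> > 0"
  shows "\<exists>C>0. \<forall>\<rho>>0. \<exists>g. bump_transform n \<delta> \<rho> (C * \<rho>) g"
proof -
  \<comment> \<open>\<open>Suc n\<close> guarantees at least one power of decay even for
    \<open>n = 0\<close>, which makes \<open>g\<close> integrable.\<close>
  obtain M K where M: "real_distribution M" and supp: "measure M {-\<delta>..\<delta>} = 1" and K: "K > 0"
    and decay: "\<And>t. norm (char M t) * (1 + t\<^sup>2) ^ Suc n \<le> K"
    using ex_smooth_distribution[OF assms, of "Suc n"] by blast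
  interpret real_distribution M by (rule M)
  have q_int: "integrable lborel (\<lambda>x::real. inverse (1 + x\<^sup>2))"
    using integrable_inverse_1_plus_square by (simp add: set_integrable_def)
  \<comment> \<open>\<open>C\<close> is independent of \<rho>: the energy density is at most a
    multiple of \<open>\<rho>^2 / (1 + (\<rho> * \<xi>)^2)\<close>, whose integral is linear in
    \<rho>. This linear growth per coordinate is the source of \<open>t ^ N\<close>. The summand 1
    makes \<open>C\<close> positive.\<close>
  define C where "C = 2 * K\<^sup>2 / pi\<^sup>2 * (LBINT x::real. inverse (1 + x\<^sup>2)) + 1"
  have "(LBINT x::real. inverse (1 + x\<^sup>2)) \<ge> 0" by (intro integral_nonneg_AE) auto
  then have C: "C > 0" by (simp add: C_def add_nonneg_pos)
  have decay': "norm (char M t) \<le> K * inverse (1 + t\<^sup>2)" "(norm (char M t))\<^sup>2 * (1 + t\<^sup>2) ^ n \<le> K\<^sup>2" for t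
  proof -
    have ge1: "1 + t\<^sup>2 \<ge> 1" by simp
    have "norm (char M t) * (1 + t\<^sup>2) ^ j \<le> K" if "j \<le> Suc n" for j
      using decay[of t] power_increasing[OF that ge1] by (meson mult_left_mono norm_ge_zero order_trans)
    from this[of 1] this[of n] this[of 0]
    have *: "norm (char M t) * (1 + t\<^sup>2) \<le> K" "norm (char M t) * (1 + t\<^sup>2) ^ n \<le> K" "norm (char M t) \<le> K"
      by auto
    show "norm (char M t) \<le> K * inverse (1 + t\<^sup>2)"
      using *(1) ge1 by (simp add: field_simps add_pos_nonneg)
    have "(norm (char M t))\<^sup>2 * (1 + t\<^sup>2) ^ n = norm (char M t) * (norm (char M t) * (1 + t\<^sup>2) ^ n)"
      by (simp add: power2_eq_square)
    also have "\<dots> \<le> K * K" using * K by (intro mult_mono) auto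
    finally show "(norm (char M t))\<^sup>2 * (1 + t\<^sup>2) ^ n \<le> K\<^sup>2" by (simp add: power2_eq_square)
  qed
  have "\<exists>g. bump_transform n \<delta> \<rho> (C * \<rho>) g" if \<rho>: "\<rho> > 0" for \<rho>
  proof -
    \<comment> \<open>The transform of the indicator of \<open>[-\<rho>, \<rho>]\<close>, divided by
      \<open>2 * pi\<close>, times that of \<open>M\<close>. At \<open>\<xi> = 0\<close> division by
      zero gives 0, as it does in the integrand of the inversion formula.\<close>
    define g where "g \<xi> = of_real (sin (\<xi> * \<rho>) / (pi * \<xi>)) * char M \<xi>" for \<xi>
    have g_meas [measurable]: "g \<in> borel_measurable borel"
      unfolding g_def by measurable
    have sinc: "(sin y)\<^sup>2 * (1 + y\<^sup>2) \<le> 2 * y\<^sup>2" for y :: real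
    proof -
      have "(sin y)\<^sup>2 \<le> y\<^sup>2" using abs_sin_x_le_abs_x[of y] by (metis abs_le_square_iff)
      moreover have "(sin y)\<^sup>2 * y\<^sup>2 \<le> 1 * y\<^sup>2" by (intro mult_right_mono) (auto simp: abs_square_le_1)
      ultimately show ?thesis by (simp add: distrib_left)
    qed
    have g_le: "norm (g \<xi>) \<le> \<rho> * K / pi * inverse (1 + \<xi>\<^sup>2)" for \<xi>
    proof -
      have "\<bar>sin (\<xi> * \<rho>) / (pi * \<xi>)\<bar> \<le> \<rho> / pi"
      proof (cases "\<xi> = 0")
        case False
        have "\<bar>sin (\<xi> * \<rho>)\<bar> \<le> \<bar>\<xi>\<bar> * \<rho>"
          using abs_sin_x_le_abs_x[of "\<xi> * \<rho>"] \<rho> by (simp add: abs_mult)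
        then show ?thesis using False by (simp add: abs_mult field_simps)
      qed (use \<rho> in auto)
      then have "norm (g \<xi>) \<le> \<rho> / pi * (K * inverse (1 + \<xi>\<^sup>2))"
        unfolding g_def norm_mult norm_of_real using \<rho> by (intro mult_mono decay') auto
      then show ?thesis by (simp add: mult_ac)
    qed
    have g_int: "integrable lborel g"
      by (rule Bochner_Integration.integrable_bound[OF integrable_mult_right[OF q_int, of "\<rho> * K / pi"]])
        (use g_le \<rho> K in \<open>auto simp: abs_mult\<close>)
    have sq_le: "(norm (g \<xi>))\<^sup>2 * (1 + \<xi>\<^sup>2) ^ n \<le> 2 * K\<^sup>2 / pi\<^sup>2 * \<rho>\<^sup>2 * inverse (1 + (0 + \<rho> * \<xi>)\<^sup>2)" for \<xi>
    proof -
      have "(sin (\<xi> * \<rho>) / (pi * \<xi>))\<^sup>2 \<le> 2 * \<rho>\<^sup>2 / pi\<^sup>2 * inverse (1 + (\<rho> * \<xi>)\<^sup>2)"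
      proof (cases "\<xi> = 0")
        case False
        have "(sin (\<xi> * \<rho>))\<^sup>2 \<le> 2 * (\<xi> * \<rho>)\<^sup>2 / (1 + (\<xi> * \<rho>)\<^sup>2)"
          using sinc[of "\<xi> * \<rho>"] by (subst pos_le_divide_eq) (auto simp: add_pos_nonneg)
        then have "(sin (\<xi> * \<rho>))\<^sup>2 / (pi * \<xi>)\<^sup>2 \<le> 2 * (\<xi> * \<rho>)\<^sup>2 / (1 + (\<xi> * \<rho>)\<^sup>2) / (pi * \<xi>)\<^sup>2"
          by (rule divide_right_mono) simp
        also have "\<dots> = 2 * \<rho>\<^sup>2 / pi\<^sup>2 * inverse (1 + (\<rho> * \<xi>)\<^sup>2)"
          using False by (simp add: power_mult_distrib divide_inverse mult_ac)
        finally show ?thesis by (simp add: power_divide)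
      qed auto
      then have "(sin (\<xi> * \<rho>) / (pi * \<xi>))\<^sup>2 * ((norm (char M \<xi>))\<^sup>2 * (1 + \<xi>\<^sup>2) ^ n)
        \<le> 2 * \<rho>\<^sup>2 / pi\<^sup>2 * inverse (1 + (\<rho> * \<xi>)\<^sup>2) * K\<^sup>2"
        by (intro mult_mono decay') auto
      then show ?thesis
        unfolding g_def norm_mult norm_of_real power_mult_distrib power2_abs
        by (simp add: mult_ac power_mult_distrib)
    qed
    have q_int': "integrable lborel (\<lambda>\<xi>. inverse (1 + (0 + \<rho> * \<xi>)\<^sup>2))"
      using \<rho> by (intro lborel_integrable_real_affine q_int) auto
    have sq_int: "integrable lborel (\<lambda>\<xi>. (norm (g \<xi>))\<^sup>2 * (1 + \<xi>\<^sup>2) ^ n)"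
    proof (rule Bochner_Integration.integrable_bound[OF integrable_mult_right[OF q_int', of "2 * K\<^sup>2 / pi\<^sup>2 * \<rho>\<^sup>2"]])
      show "AE \<xi> in lborel. norm ((norm (g \<xi>))\<^sup>2 * (1 + \<xi>\<^sup>2) ^ n)
          \<le> norm (2 * K\<^sup>2 / pi\<^sup>2 * \<rho>\<^sup>2 * inverse (1 + (0 + \<rho> * \<xi>)\<^sup>2))"
      proof (rule AE_I2)
        fix \<xi>
        have "norm ((norm (g \<xi>))\<^sup>2 * (1 + \<xi>\<^sup>2) ^ n) = (norm (g \<xi>))\<^sup>2 * (1 + \<xi>\<^sup>2) ^ n"
          by simp
        also note sq_le
        also note abs_ge_self
        finally show "norm ((norm (g \<xi>))\<^sup>2 * (1 + \<xi>\<^sup>2) ^ n)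
            \<le> norm (2 * K\<^sup>2 / pi\<^sup>2 * \<rho>\<^sup>2 * inverse (1 + (0 + \<rho> * \<xi>)\<^sup>2))"
          by (simp only: real_norm_def)
      qed
    qed measurable
    have "(LBINT \<xi>. (norm (g \<xi>))\<^sup>2 * (1 + \<xi>\<^sup>2) ^ n)
        \<le> (LBINT \<xi>. 2 * K\<^sup>2 / pi\<^sup>2 * \<rho>\<^sup>2 * inverse (1 + (0 + \<rho> * \<xi>)\<^sup>2))"
      by (intro integral_mono sq_int integrable_mult_right q_int' sq_le)
    also have "\<dots> = 2 * K\<^sup>2 / pi\<^sup>2 * \<rho>\<^sup>2 * (LBINT \<xi>. inverse (1 + (0 + \<rho> * \<xi>)\<^sup>2))"
      by (rule integral_mult_right_zero)
    also have "(LBINT \<xi>. inverse (1 + (0 + \<rho> * \<xi>)\<^sup>2)) = (LBINT x. inverse (1 + x\<^sup>2)) / \<rho>"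
      using lborel_integral_real_affine[of \<rho> "\<lambda>x. inverse (1 + x\<^sup>2)" 0] \<rho> by simp
    also have "2 * K\<^sup>2 / pi\<^sup>2 * \<rho>\<^sup>2 * \<dots> = (C - 1) * \<rho>"
      using \<rho> by (simp add: C_def power2_eq_square)
    also have "\<dots> \<le> C * \<rho>" using \<rho> by simp
    finally have sq_le': "(LBINT \<xi>. (norm (g \<xi>))\<^sup>2 * (1 + \<xi>\<^sup>2) ^ n) \<le> C * \<rho>" .
    \<comment> \<open>The inversion formula gives a limit of symmetric truncations, for end points
      without mass; as \<open>g\<close> is integrable, dominated convergence turns it into an
      integral over the line.\<close>
    have inv: "(CLBINT \<xi>. g \<xi> * cis (\<xi> * s)) = of_real (measure M {-s - \<rho><..-s + \<rho>})"
      if "measure M {-s - \<rho>} = 0" "measure M {-s + \<rho>} = 0" for s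
    proof -
      let ?F = "\<lambda>t. (iexp (-(t * (-s - \<rho>))) - iexp (-(t * (-s + \<rho>)))) / (\<i> * t) * char M t"
      have F: "1 / (2 * pi) * ?F t = g t * cis (t * s)" for t
      proof (cases "t = 0")
        case False
        have "iexp (-(t * (-s - \<rho>))) - iexp (-(t * (-s + \<rho>))) = cis (t * s) * (cis (t * \<rho>) - cis (- (t * \<rho>)))"
          by (simp add: cis_conv_exp right_diff_distrib exp_add[symmetric] algebra_simps)
        also have "cis (t * \<rho>) - cis (- (t * \<rho>)) = 2 * \<i> * sin (t * \<rho>)"
          by (simp add: complex_eq_iff)
        finally show ?thesis using False by (simp add: g_def field_simps)
      qed (simp add: g_def)
      have int: "integrable lborel (\<lambda>t. g t * cis (t * s))"
        by (rule Bochner_Integration.integrable_bound[OF g_int]) (auto simp: norm_mult cis_conv_exp)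
      have lim1: "(\<lambda>T. 1 / (2 * pi) * (CLBINT t=-T..T. ?F t)) \<longlonglongrightarrow> of_real (measure M {-s - \<rho><..-s + \<rho>})"
        using Levy_Inversion[of "-s - \<rho>" "-s + \<rho>"] that \<rho> by simp
      have eq: "1 / (2 * pi) * (CLBINT t=-T..T. ?F t) = (CLBINT t:{- real T..real T}. g t * cis (t * s))" for T :: nat
      proof -
        have "1 / (2 * pi) * (CLBINT t=-T..T. ?F t) = (CLBINT t=-T..T. 1 / (2 * pi) * ?F t)"
          by (rule interval_lebesgue_integral_mult_right[symmetric])
        also have "\<dots> = (CLBINT t=-T..T. g t * cis (t * s))" by (simp only: F)
        also have "\<dots> = (CLBINT t:{- real T..real T}. g t * cis (t * s))"
          using interval_integral_Icc[of "- real T" "real T" "\<lambda>t. g t * cis (t * s)"] by simp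
        finally show ?thesis .
      qed
      have "(\<lambda>T::nat. CLBINT t:{- real T..real T}. g t * cis (t * s)) \<longlonglongrightarrow> (CLBINT t. g t * cis (t * s))"
        unfolding set_lebesgue_integral_def
      proof (rule integral_dominated_convergence[where w = "\<lambda>t. norm (g t * cis (t * s))"])
        show "AE t in lborel. (\<lambda>T. indicat_real {- real T..real T} t *\<^sub>R (g t * cis (t * s))) \<longlonglongrightarrow> g t * cis (t * s)"
        proof (rule AE_I2)
          fix t :: real
          obtain k :: nat where k: "\<bar>t\<bar> \<le> real k" using real_arch_simple by blast
          have "eventually (\<lambda>T. indicat_real {- real T..real T} t *\<^sub>R (g t * cis (t * s)) = g t * cis (t * s)) sequentially"
            using k by (intro eventually_sequentiallyI[of k]) (auto simp: indicator_def)
          then show "(\<lambda>T. indicat_real {- real T..real T} t *\<^sub>R (g t * cis (t * s))) \<longlonglongrightarrow> g t * cis (t * s)"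
            by (rule tendsto_eventually)
        qed
      qed (use int g_int in \<open>auto simp: indicator_def norm_mult intro!: AE_I2\<close>)
      with lim1 show ?thesis unfolding eq by (rule LIMSEQ_unique[symmetric])
    qed
    have out: "measure M A = 0" if "A \<in> sets borel" "A \<inter> {-\<delta>..\<delta>} = {}" for A
    proof -
      have "measure M A + measure M {-\<delta>..\<delta>} \<le> 1"
        using that by (subst finite_measure_Union[symmetric]) auto
      then show ?thesis using supp measure_nonneg[of M A] by linarith
    qed
    \<comment> \<open>The window from \<open>-s - \<rho>\<close> to \<open>-s + \<rho>\<close>
      contains \<open>[-\<delta>, \<delta>]\<close> here and misses it in \<open>zero\<close>; the
      strict inequalities keep the end points off the support.\<close>
    have one: "(CLBINT \<xi>. g \<xi> * cis (\<xi> * s)) = 1" if "\<bar>s\<bar> < \<rho> - \<delta>" for s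
    proof -
      have "measure M {-\<delta>..\<delta>} \<le> measure M {-s - \<rho><..-s + \<rho>}"
        using that by (intro finite_measure_mono) auto
      then have "measure M {-s - \<rho><..-s + \<rho>} = 1"
        using supp prob_le_1[of "{-s - \<rho><..-s + \<rho>}"] by linarith
      moreover have "measure M {-s - \<rho>} = 0" "measure M {-s + \<rho>} = 0"
        using that by (auto intro!: out)
      ultimately show ?thesis by (simp add: inv)
    qed
    have zero: "(CLBINT \<xi>. g \<xi> * cis (\<xi> * s)) = 0" if "\<bar>s\<bar> > \<rho> + \<delta>" for s
    proof -
      have "measure M {-s - \<rho><..-s + \<rho>} = 0"
        using that by (intro out) auto
      moreover have "measure M {-s - \<rho>} = 0" "measure M {-s + \<rho>} = 0"
        using that assms \<rho> by (auto intro!: out)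
      ultimately show ?thesis by (simp add: inv)
    qed
    show ?thesis unfolding bump_transform_def using g_int sq_int sq_le' one zero by blast
  qed
  with C show ?thesis by blast
qed

section \<open>Positive definiteness and the upper bound\<close>

text \<open>Expanding the squared norm gives a double sum of characters at
  \<open>t * (a - b)\<close>. Each integrates to the kernel there, which is the similarity of
  \<open>a\<close> and \<open>b\<close> by homogeneity of the norm.\<close>

lemma similarity_form_fourier:
  fixes N :: nat and B :: "(nat \<Rightarrow> real) set"
  defines "M \<equiv> PiM {..<N} (\<lambda>_. lborel :: real measure)"
  assumes P: "\<And>z. has_bochner_integral M (\<lambda>\<xi>. P \<xi> *\<^sub>R (\<Prod>r<N. cis (\<xi> r * z r)))
       (of_real (exp (- lp_norm p N z)))"
    and p: "p \<in> {1, 2}" and t: "t > 0"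
  shows "has_bochner_integral M
    (\<lambda>\<xi>. P \<xi> * (norm (\<Sum>a\<in>B. of_real (x a) * (\<Prod>r<N. cis (\<xi> r * (t * a r)))))\<^sup>2)
    (similarity_form (scale_dist t (lp_dist p N)) B x)"
proof -
  define e where "e \<xi> a = (\<Prod>r<N. cis (\<xi> r * (t * a r)))" for \<xi> a :: "nat \<Rightarrow> real"
  have e_diff: "(\<Prod>r<N. cis (\<xi> r * (t * (a r - b r)))) = e \<xi> a * cnj (e \<xi> b)" for \<xi> a b
    by (simp add: e_def cis_cnj cis_mult right_diff_distrib flip: prod.distrib)
  have scale: "lp_norm p N (\<lambda>r. t * z r) = t * lp_norm p N z" for z
    using p t by (auto simp: lp_norm_1 lp_norm_2 abs_mult L2_set_right_distrib sum_distrib_left)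
  have "has_bochner_integral M (\<lambda>\<xi>. P \<xi> *\<^sub>R (e \<xi> a * cnj (e \<xi> b)))
      (of_real (similarity (scale_dist t (lp_dist p N)) a b))" for a b
    using P[of "\<lambda>r. t * (a r - b r)"]
    by (simp add: e_diff scale similarity_def scale_dist_def lp_dist_def)
  then have "has_bochner_integral M
      (\<lambda>\<xi>. Re (\<Sum>a\<in>B. \<Sum>b\<in>B. (x a * x b) *\<^sub>R (P \<xi> *\<^sub>R (e \<xi> a * cnj (e \<xi> b)))))
      (Re (\<Sum>a\<in>B. \<Sum>b\<in>B. (x a * x b) *\<^sub>R of_real (similarity (scale_dist t (lp_dist p N)) a b)))"
    by (intro has_bochner_integral_Re has_bochner_integral_sum has_bochner_integral_scaleR_right)
  also have "(\<lambda>\<xi>. Re (\<Sum>a\<in>B. \<Sum>b\<in>B. (x a * x b) *\<^sub>R (P \<xi> *\<^sub>R (e \<xi> a * cnj (e \<xi> b)))))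
      = (\<lambda>\<xi>. P \<xi> * (norm (\<Sum>a\<in>B. of_real (x a) * e \<xi> a))\<^sup>2)"
  proof
    fix \<xi>
    have "(\<Sum>a\<in>B. \<Sum>b\<in>B. (x a * x b) *\<^sub>R (P \<xi> *\<^sub>R (e \<xi> a * cnj (e \<xi> b))))
        = of_real (P \<xi>) * ((\<Sum>a\<in>B. of_real (x a) * e \<xi> a) * cnj (\<Sum>b\<in>B. of_real (x b) * e \<xi> b))"
    proof -
      define f where "f a = of_real (x a) * e \<xi> a" for a
      have "(\<Sum>a\<in>B. \<Sum>b\<in>B. (x a * x b) *\<^sub>R (P \<xi> *\<^sub>R (e \<xi> a * cnj (e \<xi> b))))
          = (\<Sum>a\<in>B. \<Sum>b\<in>B. of_real (P \<xi>) * (f a * cnj (f b)))"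
        by (simp add: f_def scaleR_conv_of_real mult_ac)
      also have "\<dots> = of_real (P \<xi>) * ((\<Sum>a\<in>B. f a) * cnj (\<Sum>b\<in>B. f b))"
        by (simp only: cnj_sum sum_product) (simp only: sum_distrib_left)
      finally show ?thesis by (simp only: f_def)
    qed
    also have "\<dots> = of_real (P \<xi> * (norm (\<Sum>a\<in>B. of_real (x a) * e \<xi> a))\<^sup>2)"
      by (simp only: complex_norm_square of_real_mult)
    finally show "Re (\<Sum>a\<in>B. \<Sum>b\<in>B. (x a * x b) *\<^sub>R (P \<xi> *\<^sub>R (e \<xi> a * cnj (e \<xi> b))))
        = P \<xi> * (norm (\<Sum>a\<in>B. of_real (x a) * e \<xi> a))\<^sup>2"
      by (simp only: Re_complex_of_real)
  qed
  also have "Re (\<Sum>a\<in>B. \<Sum>b\<in>B. (x a * x b) *\<^sub>R of_real (similarity (scale_dist t (lp_dist p N)) a b))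
      = similarity_form (scale_dist t (lp_dist p N)) B x"
    by (simp add: similarity_form_def mult_ac)
  finally show ?thesis by (simp only: e_def)
qed

text \<open>Duality: a function \<open>h\<close> with Fourier transform in the dual weighted \<open>L\<^sup>2\<close> space is a bounded
  functional with respect to the similarity form.\<close>
lemma similarity_form_ge_test_function:
  fixes N :: nat and B :: "(nat \<Rightarrow> real) set" and g :: "nat \<Rightarrow> real \<Rightarrow> complex"
  defines "M \<equiv> PiM {..<N} (\<lambda>_. lborel :: real measure)"
  assumes c: "c > 0" and P_ge: "\<And>\<xi>. c / (\<Prod>r<N. 1 + (\<xi> r)\<^sup>2) ^ n \<le> P \<xi>"
    and P: "\<And>z. has_bochner_integral M (\<lambda>\<xi>. P \<xi> *\<^sub>R (\<Prod>r<N. cis (\<xi> r * z r)))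
       (of_real (exp (- lp_norm p N z)))"
    and p: "p \<in> {1, 2}" and t: "t > 0"
    and g_int: "\<And>r. integrable lborel (g r)"
    and g_sq: "\<And>r. integrable lborel (\<lambda>\<xi>. (norm (g r \<xi>))\<^sup>2 * (1 + \<xi>\<^sup>2) ^ n)"
    and g_le: "\<And>r. (LBINT \<xi>. (norm (g r \<xi>))\<^sup>2 * (1 + \<xi>\<^sup>2) ^ n) \<le> E"
    and E: "E > 0"
    and h: "\<And>a. a \<in> B \<Longrightarrow> (\<Prod>r<N. CLBINT \<xi>. g r \<xi> * cis (\<xi> * (t * a r))) = of_real (h a)"
  shows "(\<Sum>a\<in>B. x a * h a)\<^sup>2 \<le> E ^ N / c * similarity_form (scale_dist t (lp_dist p N)) B x"
proof -
  interpret product_sigma_finite "\<lambda>_::nat. lborel :: real measure" ..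
  define Q where "Q = similarity_form (scale_dist t (lp_dist p N)) B x"
  define X where "X \<xi> = (\<Sum>a\<in>B. of_real (x a) * (\<Prod>r<N. cis (\<xi> r * (t * a r))))" for \<xi>
  define G where "G \<xi> = (\<Prod>r<N. g r (\<xi> r))" for \<xi>
  define W where "W \<xi> = (\<Prod>r<N. 1 + (\<xi> r)\<^sup>2) ^ n" for \<xi> :: "nat \<Rightarrow> real"
  have W: "W \<xi> > 0" for \<xi>
    unfolding W_def by (intro zero_less_power prod_pos) (simp add: add_pos_nonneg)
  have Q: "has_bochner_integral M (\<lambda>\<xi>. P \<xi> * (norm (X \<xi>))\<^sup>2) Q"
    unfolding Q_def X_def M_def by (rule similarity_form_fourier[OF P[unfolded M_def] p t])
  have gc_int: "integrable lborel (\<lambda>\<xi>. g r \<xi> * cis (\<xi> * y))" for r y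
    by (rule Bochner_Integration.integrable_bound[OF g_int[of r]])
      (use g_int[of r] in \<open>auto simp: norm_mult cis_conv_exp\<close>)
  \<comment> \<open>Pairing \<open>G\<close> with a character evaluates the test function at the
    corresponding point, so pairing it with \<open>X\<close> evaluates the functional.\<close>
  have GX: "has_bochner_integral M (\<lambda>\<xi>. G \<xi> * X \<xi>) (of_real (\<Sum>a\<in>B. x a * h a))"
  proof -
    have "has_bochner_integral M (\<lambda>\<xi>. \<Prod>r<N. g r (\<xi> r) * cis (\<xi> r * (t * a r)))
        (\<Prod>r<N. CLBINT \<xi>. g r \<xi> * cis (\<xi> * (t * a r)))" for a
      unfolding has_bochner_integral_iff M_def
      using product_integrable_prod[of "{..<N}" "\<lambda>r \<xi>. g r \<xi> * cis (\<xi> * (t * a r))"]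
        product_integral_prod[of "{..<N}" "\<lambda>r \<xi>. g r \<xi> * cis (\<xi> * (t * a r))"] gc_int
      by auto
    then have "has_bochner_integral M (\<lambda>\<xi>. \<Sum>a\<in>B. of_real (x a) * (\<Prod>r<N. g r (\<xi> r) * cis (\<xi> r * (t * a r))))
        (\<Sum>a\<in>B. of_real (x a) * (\<Prod>r<N. CLBINT \<xi>. g r \<xi> * cis (\<xi> * (t * a r))))"
      by (intro has_bochner_integral_sum has_bochner_integral_mult_right)
    then show ?thesis
      by (simp add: h G_def X_def prod.distrib sum_distrib_left mult_ac cong: sum.cong)
  qed
  have GW: "integrable M (\<lambda>\<xi>. (norm (G \<xi>))\<^sup>2 * W \<xi>)" "(\<integral>\<xi>. (norm (G \<xi>))\<^sup>2 * W \<xi> \<partial>M) \<le> E ^ N"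
  proof -
    have eq: "(norm (G \<xi>))\<^sup>2 * W \<xi> = (\<Prod>r<N. (norm (g r (\<xi> r)))\<^sup>2 * (1 + (\<xi> r)\<^sup>2) ^ n)" for \<xi>
      by (simp add: G_def W_def prod.distrib prod_power_distrib flip: prod_norm)
    show "integrable M (\<lambda>\<xi>. (norm (G \<xi>))\<^sup>2 * W \<xi>)"
      unfolding eq M_def by (rule product_integrable_prod) (use g_sq in auto)
    have "(\<integral>\<xi>. (norm (G \<xi>))\<^sup>2 * W \<xi> \<partial>M) = (\<Prod>r<N. LBINT \<xi>. (norm (g r \<xi>))\<^sup>2 * (1 + \<xi>\<^sup>2) ^ n)"
      unfolding eq M_def by (rule product_integral_prod) (use g_sq in auto)
    also have "\<dots> \<le> (\<Prod>r<N. E)"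
      by (intro prod_mono conjI g_le integral_nonneg_AE) auto
    finally show "(\<integral>\<xi>. (norm (G \<xi>))\<^sup>2 * W \<xi> \<partial>M) \<le> E ^ N" by simp
  qed
  define s where "s = \<bar>\<Sum>a\<in>B. x a * h a\<bar>"
  define D where "D = E ^ N / c"
  have D: "D > 0" using E c by (simp add: D_def)
  \<comment> \<open>Cauchy--Schwarz in the form of a weighted arithmetic-geometric mean inequality:
    it holds pointwise and only has to be integrated.\<close>
  have amgm: "2 * s \<le> l * D + Q / l" if l: "l > 0" for l
  proof -
    have pt: "2 * norm (G \<xi> * X \<xi>) \<le> l / c * ((norm (G \<xi>))\<^sup>2 * W \<xi>) + P \<xi> * (norm (X \<xi>))\<^sup>2 / l" for \<xi>
    proof -
      have "2 * norm (G \<xi>) * norm (X \<xi>) \<le> l / c * ((norm (G \<xi>))\<^sup>2 * W \<xi>) + c / W \<xi> * (norm (X \<xi>))\<^sup>2 / l"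
      proof -
        have "0 \<le> (l * W \<xi> * norm (G \<xi>) - c * norm (X \<xi>))\<^sup>2 / (l * c * W \<xi>)"
          using l c W[of \<xi>] by simp
        also have "\<dots> = l / c * ((norm (G \<xi>))\<^sup>2 * W \<xi>) + c / W \<xi> * (norm (X \<xi>))\<^sup>2 / l - 2 * norm (G \<xi>) * norm (X \<xi>)"
          using l c W[of \<xi>] by (simp add: field_simps power2_eq_square)
        finally show ?thesis by simp
      qed
      moreover have "c / W \<xi> * (norm (X \<xi>))\<^sup>2 / l \<le> P \<xi> * (norm (X \<xi>))\<^sup>2 / l"
        using P_ge[of \<xi>] l by (intro divide_right_mono mult_right_mono) (auto simp: W_def)
      ultimately show ?thesis by (simp add: norm_mult)
    qed
    have intR: "integrable M (\<lambda>\<xi>. l / c * ((norm (G \<xi>))\<^sup>2 * W \<xi>) + P \<xi> * (norm (X \<xi>))\<^sup>2 / l)"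
      using GW Q by (intro Bochner_Integration.integrable_add integrable_mult_right integrable_divide)
        (auto simp: has_bochner_integral_iff)
    have "s = norm (\<integral>\<xi>. G \<xi> * X \<xi> \<partial>M)"
      by (simp only: has_bochner_integral_integral_eq[OF GX] s_def norm_of_real)
    also have "\<dots> \<le> (\<integral>\<xi>. norm (G \<xi> * X \<xi>) \<partial>M)"
      by (rule integral_norm_bound)
    finally have "2 * s \<le> (\<integral>\<xi>. 2 * norm (G \<xi> * X \<xi>) \<partial>M)" by simp
    also have "\<dots> \<le> (\<integral>\<xi>. l / c * ((norm (G \<xi>))\<^sup>2 * W \<xi>) + P \<xi> * (norm (X \<xi>))\<^sup>2 / l \<partial>M)"
      using GX by (intro integral_mono intR pt integrable_mult_right integrable_norm)
        (auto simp: has_bochner_integral_iff)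
    also have "\<dots> = l / c * (\<integral>\<xi>. (norm (G \<xi>))\<^sup>2 * W \<xi> \<partial>M) + Q / l"
      using GW Q by (subst Bochner_Integration.integral_add)
        (auto simp: has_bochner_integral_iff)
    also have "\<dots> \<le> l / c * E ^ N + Q / l"
      using GW l c by (intro add_right_mono mult_left_mono) auto
    finally show ?thesis by (simp add: D_def)
  qed
  have "s\<^sup>2 \<le> D * Q"
  proof (cases "s = 0")
    case True
    \<comment> \<open>If \<open>Q < 0\<close>, then \<open>l = 1\<close> gives
      \<open>\<bar>Q\<bar> \<le> D\<close>, while \<open>l = \<bar>Q\<bar> / (2 * D)\<close> gives
      \<open>\<bar>Q\<bar> \<ge> 4 * D\<close>.\<close>
    have "Q \<ge> 0"
      using amgm[of 1] amgm[of "\<bar>Q\<bar> / (2 * D)"] True D by (cases "Q < 0") (auto simp: field_simps)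
    then show ?thesis using True D by simp
  next
    case False
    then have s: "s > 0" by (simp add: s_def)
    have "2 * s \<le> s / D * D + Q / (s / D)" using s D by (intro amgm) auto
    then show ?thesis using s D by (simp add: field_simps power2_eq_square)
  qed
  then show ?thesis by (simp add: s_def D_def Q_def)
qed

text \<open>A test function that is 1 at a point \<open>a0\<close> with
  \<open>x a0 \<noteq> 0\<close> and 0 at the rest of \<open>B\<close> bounds
  \<open>(x a0)^2\<close> by a multiple of the form.\<close>

lemma stably_positive_definite_lp:
  assumes p: "p \<in> {1, 2}" and A: "A \<subseteq> lp_space N"
  shows "stably_positive_definite (lp_dist p N) A"
  unfolding stably_positive_definite_def positive_definite_def finite_positive_definite_altdef
proof (intro allI impI conjI)
  fix t :: real and B and x :: "(nat \<Rightarrow> real) \<Rightarrow> real" assume t: "t > 0" and B: "B \<subseteq> A" "finite B" and "\<exists>a\<in>B. x a \<noteq> 0"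
  then obtain a0 where a0: "a0 \<in> B" "x a0 \<noteq> 0" by blast
  obtain P c n where P: "c > 0" "\<And>\<xi>. c / (\<Prod>r<N. 1 + (\<xi> r)\<^sup>2) ^ n \<le> P \<xi>"
    "\<And>z. has_bochner_integral (PiM {..<N} (\<lambda>_. lborel)) (\<lambda>\<xi>. P \<xi> *\<^sub>R (\<Prod>r<N. cis (\<xi> r * z r)))
       (of_real (exp (- lp_norm p N z)))"
    by (rule lp_kernel_fourier[OF p, where N = N]) (rule that)
  have sep: "\<exists>r<N. \<bar>t * a r - t * a0 r\<bar> > 0" if "a \<in> B" "a \<noteq> a0" for a
  proof -
    have "a \<in> lp_space N" "a0 \<in> lp_space N" using that a0 A B by auto
    then have "\<exists>r<N. a r \<noteq> a0 r"
      using that unfolding lp_space_def by (metis PiE_ext lessThan_iff)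
    then show ?thesis using t by auto
  qed
  then obtain r where r: "\<And>a. a \<in> B \<Longrightarrow> a \<noteq> a0 \<Longrightarrow> r a < N \<and> \<bar>t * a (r a) - t * a0 (r a)\<bar> > 0"
    by metis
  \<comment> \<open>The inserted 1 covers the case that \<open>a0\<close> is the only point of
    \<open>B\<close>.\<close>
  define d where "d = Min (insert 1 ((\<lambda>a. \<bar>t * a (r a) - t * a0 (r a)\<bar>) ` (B - {a0})))"
  have d: "d > 0"
    unfolding d_def using B r by (subst Min_gr_iff) auto
  have d_le: "d \<le> \<bar>t * a (r a) - t * a0 (r a)\<bar>" if "a \<in> B" "a \<noteq> a0" for a
    unfolding d_def using B that by (intro Min_le) auto
  \<comment> \<open>With \<open>\<rho> = 2 * \<delta>\<close> the bump is 1 near 0 and vanishes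
    beyond \<open>3 * \<delta> < d\<close>.\<close>
  define \<delta> where "\<delta> = d / 4"
  have \<delta>: "\<delta> > 0" using d by (simp add: \<delta>_def)
  obtain C where C: "C > 0" and bump: "\<And>\<rho>. \<rho> > 0 \<Longrightarrow> \<exists>g. bump_transform n \<delta> \<rho> (C * \<rho>) g"
    using ex_bump[OF \<delta>] by blast
  obtain g where "bump_transform n \<delta> (2 * \<delta>) (C * (2 * \<delta>)) g"
    using bump[of "2 * \<delta>"] \<delta> by auto
  then have g: "integrable lborel g"
     "integrable lborel (\<lambda>\<xi>. (norm (g \<xi>))\<^sup>2 * (1 + \<xi>\<^sup>2) ^ n)"
     "(LBINT \<xi>. (norm (g \<xi>))\<^sup>2 * (1 + \<xi>\<^sup>2) ^ n) \<le> C * (2 * \<delta>)"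
     "\<And>s. \<bar>s\<bar> < 2 * \<delta> - \<delta> \<Longrightarrow> (CLBINT \<xi>. g \<xi> * cis (\<xi> * s)) = 1"
     "\<And>s. \<bar>s\<bar> > 2 * \<delta> + \<delta> \<Longrightarrow> (CLBINT \<xi>. g \<xi> * cis (\<xi> * s)) = 0"
    unfolding bump_transform_def by blast+
  \<comment> \<open>Modulation moves the centre of the bump to \<open>t * a0\<close>. At any other
    point one vanishing factor kills the product.\<close>
  define g' where "g' i \<xi> = g \<xi> * cis (\<xi> * (- (t * a0 i)))" for i \<xi>
  have g'_norm: "norm (g' i \<xi>) = norm (g \<xi>)" for i \<xi> by (simp add: g'_def norm_mult)
  have g'_cis: "g' i \<xi> * cis (\<xi> * (t * a i)) = g \<xi> * cis (\<xi> * (t * a i - t * a0 i))" for i \<xi> a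
    by (simp add: g'_def mult.assoc cis_mult algebra_simps)
  have g'_int: "integrable lborel (g' i)" for i
    by (rule Bochner_Integration.integrable_bound[OF g(1)])
      (use g(1) in \<open>auto simp: g'_norm, auto simp: g'_def[abs_def] cis_conv_exp\<close>)
  have h: "(\<Prod>i<N. CLBINT \<xi>. g' i \<xi> * cis (\<xi> * (t * a i))) = of_real (of_bool (a = a0))" if "a \<in> B" for a
  proof (cases "a = a0")
    case True
    then show ?thesis using g(4)[of 0] \<delta> by (simp add: g'_cis)
  next
    case False
    have "2 * \<delta> + \<delta> < \<bar>t * a (r a) - t * a0 (r a)\<bar>"
      using d_le[OF that False] d by (simp add: \<delta>_def)
    then have "(CLBINT \<xi>. g' (r a) \<xi> * cis (\<xi> * (t * a (r a)))) = 0"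
      unfolding g'_cis by (rule g(5))
    then have "(\<Prod>i<N. CLBINT \<xi>. g' i \<xi> * cis (\<xi> * (t * a i))) = 0"
      using r[OF that False] by (intro prod_zero) auto
    then show ?thesis using False by simp
  qed
  have "(\<Sum>a\<in>B. x a * of_bool (a = a0))\<^sup>2
      \<le> (C * (2 * \<delta>)) ^ N / c * similarity_form (scale_dist t (lp_dist p N)) B x"
  proof (rule similarity_form_ge_test_function[OF P p t, where g = g'])
    show "C * (2 * \<delta>) > 0" using C \<delta> by simp
  qed (use g'_int h g(2,3) in \<open>simp_all only: g'_norm\<close>)
  moreover have "(\<Sum>a\<in>B. x a * of_bool (a = a0)) = x a0"
    using a0 B by (simp add: of_bool_def sum.delta if_distrib cong: if_cong)
  ultimately have "0 < (C * (2 * \<delta>)) ^ N / c * similarity_form (scale_dist t (lp_dist p N)) B x"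
    using a0 by (smt (verit) zero_less_power2)
  moreover have "0 < (C * (2 * \<delta>)) ^ N / c" using C P(1) \<delta> by simp
  ultimately show "similarity_form (scale_dist t (lp_dist p N)) B x > 0"
    by (rule zero_less_mult_pos)
qed

text \<open>A product of bumps equal to 1 on the scaled set has energy at most
  \<open>(C * \<rho>) ^ N\<close> with \<rho> of order \<open>t\<close>. For \<open>h = 1\<close>
  duality is exactly the hypothesis of \<open>finite_magnitude_le\<close>.\<close>

lemma finite_magnitude_lp_upper:
  assumes p: "p \<in> {1, 2}" and R: "R \<ge> 0"
  obtains K where "\<And>t B. t \<ge> 1 \<Longrightarrow> B \<subseteq> lp_space N \<Longrightarrow> finite B \<Longrightarrow> \<forall>a\<in>B. \<forall>r<N. \<bar>a r\<bar> \<le> R \<Longrightarrow>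
    finite_magnitude (scale_dist t (lp_dist p N)) B \<le> K * t ^ N"
proof -
  obtain P c n where P: "c > 0" "\<And>\<xi>. c / (\<Prod>r<N. 1 + (\<xi> r)\<^sup>2) ^ n \<le> P \<xi>"
    "\<And>z. has_bochner_integral (PiM {..<N} (\<lambda>_. lborel)) (\<lambda>\<xi>. P \<xi> *\<^sub>R (\<Prod>r<N. cis (\<xi> r * z r)))
       (of_real (exp (- lp_norm p N z)))"
    by (rule lp_kernel_fourier[OF p, where N = N]) (rule that)
  obtain C where C: "C > 0" and bump: "\<And>\<rho>. \<rho> > 0 \<Longrightarrow> \<exists>g. bump_transform n 1 \<rho> (C * \<rho>) g"
    using ex_bump[OF zero_less_one] by blast
  define K where "K = (C * (R + 2)) ^ N / c"
  have "finite_magnitude (scale_dist t (lp_dist p N)) B \<le> K * t ^ N"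
    if t: "t \<ge> 1" and B: "B \<subseteq> lp_space N" "finite B" and BR: "\<And>a r. a \<in> B \<Longrightarrow> r < N \<Longrightarrow> \<bar>a r\<bar> \<le> R" for t B
  proof -
    \<comment> \<open>The plateau \<open>\<bar>s\<bar> < \<rho> - 1 = t * R + 1\<close> then
      contains all scaled coordinates.\<close>
    define \<rho> where "\<rho> = t * R + 2"
    have \<rho>: "\<rho> > 0" using t R by (simp add: \<rho>_def add_nonneg_pos)
    obtain g where "bump_transform n 1 \<rho> (C * \<rho>) g"
      using bump[OF \<rho>] by auto
    then have g: "integrable lborel g"
       "integrable lborel (\<lambda>\<xi>. (norm (g \<xi>))\<^sup>2 * (1 + \<xi>\<^sup>2) ^ n)"
       "(LBINT \<xi>. (norm (g \<xi>))\<^sup>2 * (1 + \<xi>\<^sup>2) ^ n) \<le> C * \<rho>"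
       "\<And>s. \<bar>s\<bar> < \<rho> - 1 \<Longrightarrow> (CLBINT \<xi>. g \<xi> * cis (\<xi> * s)) = 1"
      unfolding bump_transform_def by blast+
    have h: "(\<Prod>i<N. CLBINT \<xi>. g \<xi> * cis (\<xi> * (t * a i))) = of_real 1" if "a \<in> B" for a
    proof -
      have "\<bar>t * a i\<bar> < \<rho> - 1" if "i < N" for i
      proof -
        have "\<bar>t * a i\<bar> = t * \<bar>a i\<bar>" using t by (simp add: abs_mult)
        also have "\<dots> \<le> t * R" using BR[OF \<open>a \<in> B\<close> that] t by (intro mult_left_mono) auto
        finally show ?thesis by (simp add: \<rho>_def)
      qed
      then show ?thesis by (simp add: g(4))
    qed
    have main: "(\<Sum>a\<in>B. x a * 1)\<^sup>2 \<le> (C * \<rho>) ^ N / c * similarity_form (scale_dist t (lp_dist p N)) B x" for x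
    proof (rule similarity_form_ge_test_function[OF P p, where g = "\<lambda>_. g"])
      show "C * \<rho> > 0" "t > 0" using C \<rho> t by simp_all
    qed (use h g(1-3) in simp_all)
    have "finite_positive_definite (scale_dist t (lp_dist p N)) B"
      using stably_positive_definite_lp[OF p B(1)] t B
      by (auto simp: stably_positive_definite_def positive_definite_def)
    then have "finite_magnitude (scale_dist t (lp_dist p N)) B \<le> (C * \<rho>) ^ N / c"
      using main C \<rho> P(1) by (intro finite_magnitude_le) auto
    also have "\<dots> \<le> (C * ((R + 2) * t)) ^ N / c"
      using t R C P(1) \<rho> by (intro divide_right_mono power_mono mult_left_mono) (auto simp: \<rho>_def algebra_simps)
    also have "\<dots> = K * t ^ N" by (simp add: K_def power_mult_distrib)
    finally show ?thesis .
  qed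
  then show ?thesis by (rule that) (assumption | blast)+
qed

section \<open>The lower bound and the growth of the magnitude function\<close>

lemma abs_le_lp_norm:
  assumes "p \<in> {1, 2}" "r < N"
  shows "\<bar>z r\<bar> \<le> lp_norm p N z"
proof (cases "p = 1")
  case True
  then show ?thesis
    using assms member_le_sum[of r "{..<N}" "\<lambda>r. \<bar>z r\<bar>"] by (simp add: lp_norm_1)
next
  case False
  then have "p = 2" using assms by simp
  moreover have "\<bar>z r\<bar> \<le> L2_set (\<lambda>r. \<bar>z r\<bar>) {..<N}"
    using assms by (intro member_le_L2_set) auto
  ultimately show ?thesis by (simp add: lp_norm_2 L2_set_def)
qed

lemma compactin_lp_bounded:
  assumes p: "p \<in> {1, 2}" and "compactin (lp_topology p N) A"
  obtains R where "R \<ge> 0" "A \<subseteq> lp_space N" "\<And>a r. a \<in> A \<Longrightarrow> r < N \<Longrightarrow> \<bar>a r\<bar> \<le> R"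
proof -
  interpret Metric_space "lp_space N" "lp_dist p N" by (rule Metric_space_lp[OF p])
  have "mbounded A"
    using assms compactin_imp_mbounded by (simp add: lp_topology_def)
  then obtain x b where xb: "A \<subseteq> mcball x b" by (auto simp: mbounded_def)
  define R where "R = \<bar>b\<bar> + (\<Sum>r<N. \<bar>x r\<bar>)"
  show ?thesis
  proof
    show "R \<ge> 0" by (simp add: R_def sum_nonneg)
    show "A \<subseteq> lp_space N" using xb mcball_subset_mspace by blast
    fix a r assume a: "a \<in> A" and r: "r < N"
    have "\<bar>x r - a r\<bar> \<le> lp_dist p N x a"
      unfolding lp_dist_def using abs_le_lp_norm[OF p r, of "\<lambda>r. x r - a r"] by simp
    moreover have "lp_dist p N x a \<le> b" using xb a by auto
    moreover have "\<bar>x r\<bar> \<le> (\<Sum>r<N. \<bar>x r\<bar>)"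
      using r by (intro member_le_sum) auto
    ultimately show "\<bar>a r\<bar> \<le> R" by (simp add: R_def)
  qed
qed

text \<open>On either side of \<open>u\<close> the distance to \<open>u\<close> is injective, so
  each half is dominated by a full geometric series.\<close>

lemma sum_geometric_abs_le:
  fixes q :: real and F :: "int set"
  assumes "0 < q" "q < 1" and F: "finite F"
  shows "(\<Sum>j\<in>F. q ^ nat \<bar>j - u\<bar>) \<le> 2 / (1 - q)"
proof -
  have half: "(\<Sum>j\<in>G. q ^ nat \<bar>j - u\<bar>) \<le> 1 / (1 - q)"
    if G: "finite G" "inj_on (\<lambda>j. nat \<bar>j - u\<bar>) G" for G
  proof -
    have "(\<Sum>j\<in>G. q ^ nat \<bar>j - u\<bar>) = (\<Sum>k\<in>(\<lambda>j. nat \<bar>j - u\<bar>) ` G. q ^ k)"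
      using G by (simp add: sum.reindex)
    also have "\<dots> \<le> (\<Sum>k. q ^ k)"
      using assms G by (intro sum_le_suminf summable_geometric) auto
    also have "\<dots> = 1 / (1 - q)" using assms by (intro suminf_geometric) auto
    finally show ?thesis .
  qed
  have "(\<Sum>j\<in>F. q ^ nat \<bar>j - u\<bar>) = (\<Sum>j\<in>F \<inter> {u..}. q ^ nat \<bar>j - u\<bar>) + (\<Sum>j\<in>F \<inter> {..<u}. q ^ nat \<bar>j - u\<bar>)"
    using F by (subst sum.union_disjoint[symmetric]) (auto intro!: sum.cong)
  also have "\<dots> \<le> 1 / (1 - q) + 1 / (1 - q)"
    using F by (intro add_mono half) (auto simp: inj_on_def)
  finally show ?thesis by simp
qed

text \<open>Cells of side \<open>1 / t\<close> have volume \<open>(1 / t) ^ N\<close>, which bounds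
  from below how many meet \<open>A\<close>. Similarity decays geometrically in the cell indices, so
  \<open>finite_magnitude_ge\<close> applies with \<open>K\<close> independent of
  \<open>t\<close>.\<close>

lemma finite_magnitude_lp_lower:
  assumes p: "p \<in> {1, 2}" and A: "A \<subseteq> lp_space N"
    and R: "\<And>a r. a \<in> A \<Longrightarrow> r < N \<Longrightarrow> \<bar>a r\<bar> \<le> R"
    and pos: "emeasure (lebesgue_power N) A > 0"
  obtains c where "c > 0"
    "\<And>t. t > 0 \<Longrightarrow> \<exists>B\<subseteq>A. finite B \<and> c * t ^ N \<le> finite_magnitude (scale_dist t (lp_dist p N)) B"
proof -
  interpret product_sigma_finite "\<lambda>_::nat. lborel :: real measure" ..
  \<comment> \<open>Each \<open>\<bar>z r\<bar>\<close> is at most the norm, hence so is their sum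
    divided by \<open>Suc N\<close>; \<open>q\<close> is the resulting decay per cell and
    coordinate. \<open>Suc N\<close> keeps \<open>q < 1\<close> when \<open>N = 0\<close>.\<close>
  define q where "q = exp (- 1 / real (Suc N))"
  have q: "0 < q" "q < 1" by (auto simp: q_def)
  have q_inverse: "exp (1 / real (Suc N)) = 1 / q"
    unfolding q_def minus_divide_left[symmetric] exp_minus by (simp only: inverse_eq_divide) simp
  define K where "K = (1 / q * (2 / (1 - q))) ^ N"
  have K: "K > 0" using q by (simp add: K_def)
  \<comment> \<open>\<open>enn2real\<close> sends infinity to 0; the finiteness proved in
    \<open>main\<close> makes \<open>m\<close> the actual measure.\<close>
  define m where "m = enn2real (emeasure (lebesgue_power N) A)"
  have main: "emeasure (lebesgue_power N) A < \<infinity> \<and>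
     (\<exists>B\<subseteq>A. finite B \<and> m / K * t ^ N \<le> finite_magnitude (scale_dist t (lp_dist p N)) B)"
    if t: "t > 0" for t
  proof -
    let ?d = "scale_dist t (lp_dist p N)"
    define k where "k a = restrict (\<lambda>r. \<lfloor>t * a r\<rfloor>) {..<N}" for a
    have k_fin: "finite (k ` A)"
    proof (rule finite_subset)
      show "k ` A \<subseteq> {..<N} \<rightarrow>\<^sub>E {\<lfloor>- (t * R)\<rfloor>..\<lfloor>t * R\<rfloor>}"
      proof (intro image_subsetI PiE_I)
        fix a r assume "a \<in> A" "r \<in> {..<N}"
        then have "\<bar>a r\<bar> \<le> R" using R by auto
        then have "a r \<le> R" "- R \<le> a r" by auto
        then have "t * a r \<le> t * R" "t * (- R) \<le> t * a r"
          using t by (meson less_imp_le mult_left_mono)+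
        then show "k a r \<in> {\<lfloor>- (t * R)\<rfloor>..\<lfloor>t * R\<rfloor>}"
          using \<open>r \<in> {..<N}\<close> by (auto simp: k_def intro!: floor_mono)
      qed (auto simp: k_def)
    qed (rule finite_PiE, simp_all)
    define cell where "cell \<kappa> = (\<Pi>\<^sub>E r\<in>{..<N}. {of_int (\<kappa> r) / t..<(of_int (\<kappa> r) + 1) / t})"
      for \<kappa> :: "nat \<Rightarrow> int"
    have cell_sets: "cell \<kappa> \<in> sets (PiM {..<N} (\<lambda>_. lborel))" for \<kappa>
      unfolding cell_def by (intro sets_PiM_I_finite) auto
    have cell_measure: "emeasure (lebesgue_power N) (cell \<kappa>) = ennreal ((1 / t) ^ N)" for \<kappa>
    proof -
      have "emeasure (lebesgue_power N) (cell \<kappa>) = emeasure (PiM {..<N} (\<lambda>_. lborel)) (cell \<kappa>)"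
        using cell_sets by (simp add: lebesgue_power_def)
      also have "\<dots> = (\<Prod>r<N. ennreal (1 / t))"
        unfolding cell_def using t by (subst emeasure_PiM) (auto simp: diff_divide_distrib[symmetric] divide_right_mono)
      also have "\<dots> = ennreal ((1 / t) ^ N)"
        using t by (simp add: ennreal_power)
      finally show ?thesis .
    qed
    have cover: "A \<subseteq> (\<Union>\<kappa>\<in>k ` A. cell \<kappa>)"
    proof
      fix a assume a: "a \<in> A"
      have "a \<in> cell (k a)"
        unfolding cell_def
      proof (rule PiE_I)
        show "a r = undefined" if "r \<notin> {..<N}" for r
          using A a that by (auto simp: lp_space_def)
        fix r assume "r \<in> {..<N}"
        then show "a r \<in> {of_int (k a r) / t..<(of_int (k a r) + 1) / t}"
          using t of_int_floor_le[of "t * a r"] real_of_int_floor_add_one_gt[of "t * a r"]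
          by (simp add: k_def pos_divide_le_eq pos_less_divide_eq mult.commute[of "a r"])
      qed
      then show "a \<in> (\<Union>\<kappa>\<in>k ` A. cell \<kappa>)" using a by blast
    qed
    have cell_sets': "cell \<kappa> \<in> sets (lebesgue_power N)" for \<kappa>
      using cell_sets by (simp add: lebesgue_power_def)
    have "emeasure (lebesgue_power N) A \<le> emeasure (lebesgue_power N) (\<Union>\<kappa>\<in>k ` A. cell \<kappa>)"
      by (intro emeasure_mono[OF cover] sets.finite_UN k_fin cell_sets')
    also have "\<dots> \<le> (\<Sum>\<kappa>\<in>k ` A. emeasure (lebesgue_power N) (cell \<kappa>))"
      by (rule emeasure_subadditive_finite[OF k_fin]) (use cell_sets' in blast)
    also have "\<dots> = ennreal (real (card (k ` A)) * (1 / t) ^ N)"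
      using t by (simp only: cell_measure sum_constant ennreal_of_nat_eq_real_of_nat)
        (intro ennreal_mult[symmetric]; simp)
    finally have vol: "emeasure (lebesgue_power N) A \<le> ennreal (real (card (k ` A)) * (1 / t) ^ N)" .
    then have fin: "emeasure (lebesgue_power N) A < \<infinity>"
      by (simp add: le_less_trans)
    have "m \<le> real (card (k ` A)) * (1 / t) ^ N"
      unfolding m_def by (rule enn2real_leI[OF _ vol]) (use t in simp)
    then have "m * t ^ N \<le> real (card (k ` A)) * (1 / t) ^ N * t ^ N"
      using t by (intro mult_right_mono) auto
    then have card_ge: "m * t ^ N \<le> real (card (k ` A))"
      using t by (simp add: power_divide)
    define f where "f \<kappa> = (SOME a. a \<in> A \<and> k a = \<kappa>)" for \<kappa>
    have f: "f \<kappa> \<in> A" "k (f \<kappa>) = \<kappa>" if "\<kappa> \<in> k ` A" for \<kappa>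
      using someI_ex[of "\<lambda>a. a \<in> A \<and> k a = \<kappa>"] that unfolding f_def by auto
    have f_inj: "inj_on f (k ` A)" using f by (metis inj_onI)
    define B where "B = f ` k ` A"
    have B: "B \<subseteq> A" "finite B" "card B = card (k ` A)"
      using f k_fin f_inj by (auto simp: B_def card_image)
    have k_inj: "inj_on k B" using f by (auto simp: B_def inj_on_def)
    have sim: "similarity ?d a b \<le> (\<Prod>r<N. 1 / q * q ^ nat \<bar>k b r - k a r\<bar>)" for a b
    proof -
      have "t * lp_dist p N a b \<ge> (\<Sum>r<N. t * \<bar>a r - b r\<bar> / real (Suc N))"
      proof -
        have "(\<Sum>r<N. t * \<bar>a r - b r\<bar> / real (Suc N)) \<le> (\<Sum>r<N. t * lp_dist p N a b / real (Suc N))"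
          using t abs_le_lp_norm[OF p, of _ N "\<lambda>r. a r - b r"]
          by (intro sum_mono divide_right_mono mult_left_mono) (auto simp: lp_dist_def)
        also have "\<dots> = t * lp_dist p N a b * (real N / real (Suc N))" by simp
        also have "\<dots> \<le> t * lp_dist p N a b * 1"
          using t by (intro mult_left_mono) (auto simp: lp_dist_def lp_norm_def)
        finally show ?thesis by simp
      qed
      then have "similarity ?d a b \<le> exp (- (\<Sum>r<N. t * \<bar>a r - b r\<bar> / real (Suc N)))"
        by (simp add: similarity_def scale_dist_def)
      also have "\<dots> = (\<Prod>r<N. exp (- (t * \<bar>a r - b r\<bar> / real (Suc N))))"
        by (simp add: exp_sum sum_negf[symmetric])
      also have "\<dots> \<le> (\<Prod>r<N. 1 / q * q ^ nat \<bar>k b r - k a r\<bar>)"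
      proof (intro prod_mono conjI)
        fix r assume r: "r \<in> {..<N}"
        \<comment> \<open>Taking floors changes the difference by less than 1, at the cost of one
          factor \<open>1 / q\<close> per coordinate.\<close>
        have "t * \<bar>a r - b r\<bar> = \<bar>t * a r - t * b r\<bar>"
          using t by (simp add: abs_mult flip: right_diff_distrib)
        also have "\<dots> \<ge> real_of_int \<bar>\<lfloor>t * b r\<rfloor> - \<lfloor>t * a r\<rfloor>\<bar> - 1"
          by linarith
        finally have "real_of_int \<bar>k b r - k a r\<bar> - 1 \<le> t * \<bar>a r - b r\<bar>"
          using r by (simp add: k_def)
        then have "- (t * \<bar>a r - b r\<bar> / real (Suc N)) \<le> (1 - real_of_int \<bar>k b r - k a r\<bar>) / real (Suc N)"
          unfolding minus_divide_left by (intro divide_right_mono) auto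
        also have "\<dots> = 1 / real (Suc N) + real (nat \<bar>k b r - k a r\<bar>) * (- 1 / real (Suc N))"
          unfolding of_nat_nat[OF abs_ge_zero] by (simp only: diff_divide_distrib) simp
        finally have "exp (- (t * \<bar>a r - b r\<bar> / real (Suc N)))
            \<le> exp (1 / real (Suc N) + real (nat \<bar>k b r - k a r\<bar>) * (- 1 / real (Suc N)))"
          by (simp only: exp_le_cancel_iff)
        also have "\<dots> = 1 / q * q ^ nat \<bar>k b r - k a r\<bar>"
          unfolding exp_add exp_of_nat_mult q_inverse by (simp only: q_def)
        finally show "exp (- (t * \<bar>a r - b r\<bar> / real (Suc N))) \<le> 1 / q * q ^ nat \<bar>k b r - k a r\<bar>" .
      qed simp
      finally show ?thesis .
    qed
    have rows: "(\<Sum>b\<in>B. similarity ?d a b) \<le> K" for a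
    proof -
      \<comment> \<open>Enlarging the occupied cells to a full box lets the sum factor over the
        coordinates.\<close>
      define F where "F r = (\<lambda>\<kappa>. \<kappa> r) ` k ` A" for r
      have F: "finite (F r)" for r using k_fin by (simp add: F_def)
      have "(\<Sum>b\<in>B. similarity ?d a b) \<le> (\<Sum>b\<in>B. \<Prod>r<N. 1 / q * q ^ nat \<bar>k b r - k a r\<bar>)"
        by (intro sum_mono sim)
      also have "\<dots> = (\<Sum>\<kappa>\<in>k ` B. \<Prod>r<N. 1 / q * q ^ nat \<bar>\<kappa> r - k a r\<bar>)"
        using k_inj by (simp add: sum.reindex)
      also have "\<dots> \<le> (\<Sum>\<kappa>\<in>PiE {..<N} F. \<Prod>r<N. 1 / q * q ^ nat \<bar>\<kappa> r - k a r\<bar>)"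
      proof (rule sum_mono2)
        show "finite (PiE {..<N} F)" using F by (intro finite_PiE) auto
        show "k ` B \<subseteq> PiE {..<N} F"
        proof (intro image_subsetI PiE_I)
          fix b r assume "b \<in> B"
          then show "k b r \<in> F r" using B(1) by (auto simp only: F_def)
        qed (auto simp: k_def)
        show "0 \<le> (\<Prod>r<N. 1 / q * q ^ nat \<bar>\<kappa> r - k a r\<bar>)" for \<kappa>
          using q by (intro prod_nonneg ballI mult_nonneg_nonneg) simp_all
      qed
      also have "\<dots> = (\<Prod>r<N. \<Sum>j\<in>F r. 1 / q * q ^ nat \<bar>j - k a r\<bar>)"
        by (rule prod_sum_PiE[symmetric]) (use F in simp_all)
      also have "\<dots> \<le> (\<Prod>r<N. 1 / q * (2 / (1 - q)))"
      proof (intro prod_mono conjI)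
        fix r
        show "0 \<le> (\<Sum>j\<in>F r. 1 / q * q ^ nat \<bar>j - k a r\<bar>)"
          using q by (intro sum_nonneg) auto
        show "(\<Sum>j\<in>F r. 1 / q * q ^ nat \<bar>j - k a r\<bar>) \<le> 1 / q * (2 / (1 - q))"
          unfolding sum_distrib_left[symmetric]
          using q F by (intro mult_left_mono sum_geometric_abs_le) auto
      qed
      also have "\<dots> = K" by (simp add: K_def)
      finally show ?thesis .
    qed
    have "finite_positive_definite ?d B"
      using stably_positive_definite_lp[OF p A] t B
      by (auto simp: stably_positive_definite_def positive_definite_def)
    then have "real (card B) / K \<le> finite_magnitude ?d B"
    proof (rule finite_magnitude_ge[OF _ K])
      show "?d a b = ?d b a" for a b
        by (simp add: scale_dist_def lp_dist_def lp_norm_def abs_minus_commute)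
    qed (rule rows)
    moreover have "m / K * t ^ N \<le> real (card B) / K"
      using card_ge K B by (simp add: divide_right_mono)
    ultimately show ?thesis using fin B by (intro conjI exI[of _ B]) auto
  qed
  have "m > 0"
    unfolding m_def using main[of 1] pos by (simp add: enn2real_positive_iff)
  then have "m / K > 0" using K by simp
  then show ?thesis by (rule that) (use main in simp)
qed

section \<open>Growth exponents\<close>

text \<open>The empty subspace contributes magnitude 0 to the supremum.\<close>

lemma positive_definite_nonneg_magnitude:
  assumes "positive_definite d A"
  shows "magnitude d A \<ge> 0"
proof -
  have "finite_positive_definite d {}" by (simp add: finite_positive_definite_def)
  then obtain w where "weighting d {} w" "finite_magnitude d {} = (\<Sum>a\<in>{}. w a)"
    by (rule finite_positive_definite_weighting)
  then have "0 = ereal (finite_magnitude d {})" by simp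
  also have "ereal (finite_magnitude d {}) \<le> magnitude d A"
    using assms unfolding magnitude_def by (auto intro!: SUP_upper)
  finally show ?thesis .
qed

lemma growth_le_power:
  assumes "\<And>t. t \<ge> 1 \<Longrightarrow> 0 \<le> f t" "\<And>t. t \<ge> 1 \<Longrightarrow> f t \<le> ereal (K * t ^ N)"
  shows "growth f \<le> ereal (real N)"
  unfolding growth_def
proof (rule INF_lower, rule CollectI, intro exI eventually_at_top_linorderI)
  fix t :: real assume t: "t \<ge> 1"
  then obtain y where y: "f t = ereal y" "0 \<le> y" "y \<le> K * t ^ N"
    using assms[OF t] by (cases "f t") auto
  show "\<bar>f t / ereal (t powr real N)\<bar> \<le> ereal K"
    using y t by (simp add: powr_realpow pos_divide_le_eq)
qed

text \<open>An admissible exponent \<open>\<nu> < N\<close> would bound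
  \<open>c * t powr (N - \<nu>)\<close>, which tends to infinity.\<close>

lemma growth_ge_power:
  assumes c: "c > 0" and "\<And>t. t \<ge> 1 \<Longrightarrow> ereal (c * t ^ N) \<le> f t"
  shows "ereal (real N) \<le> growth f"
  unfolding growth_def
proof (rule INF_greatest)
  fix \<nu> assume "\<nu> \<in> {\<nu>. \<exists>C. \<forall>\<^sub>F t in at_top. \<bar>f t / ereal (t powr \<nu>)\<bar> \<le> ereal C}"
  then obtain C where C: "\<forall>\<^sub>F t in at_top. \<bar>f t / ereal (t powr \<nu>)\<bar> \<le> ereal C" by blast
  have "real N \<le> \<nu>"
  proof (rule ccontr)
    assume "\<not> real N \<le> \<nu>"
    then have gap: "real N - \<nu> > 0" by simp
    have abs_ge: "y \<le> \<bar>y\<bar>" for y :: ereal by (cases y) auto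
    have "\<forall>\<^sub>F t in at_top. c * t powr (real N - \<nu>) \<le> C"
      using C eventually_ge_at_top[of 1]
    proof eventually_elim
      case (elim t)
      then have t: "t \<ge> 1" by simp
      have "ereal (c * t powr (real N - \<nu>)) = ereal (c * t ^ N) / ereal (t powr \<nu>)"
        using t by (simp add: powr_diff powr_realpow)
      also have "\<dots> \<le> f t / ereal (t powr \<nu>)"
        using assms(2)[OF t] t by (intro ereal_divide_right_mono) auto
      also have "\<dots> \<le> \<bar>f t / ereal (t powr \<nu>)\<bar>"
        by (rule abs_ge)
      also have "\<dots> \<le> ereal C" using elim by simp
      finally show ?case by simp
    qed
    moreover have "filterlim (\<lambda>t. c * t powr (real N - \<nu>)) at_top at_top"
      using c gap by real_asymp
    then have "\<forall>\<^sub>F t in at_top. c * t powr (real N - \<nu>) > C"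
      by (simp add: filterlim_at_top_dense)
    ultimately have "\<forall>\<^sub>F t::real in at_top. False"
      by eventually_elim simp
    then show False by simp
  qed
  then show "ereal (real N) \<le> ereal \<nu>" by simp
qed

theorem theorem3p5p8:
  fixes p :: real and N :: nat and A :: "(nat \<Rightarrow> real) set"
  assumes "p \<in> {1, 2}"
    and "compactin (lp_topology p N) A"
  shows "magnitude_dimension (lp_dist p N) A \<le> ereal (real N) \<and>
    (emeasure (lebesgue_power N) A > 0 \<longrightarrow>
       magnitude_dimension (lp_dist p N) A = ereal (real N))"
proof -
  obtain R where R: "R \<ge> 0" "A \<subseteq> lp_space N" "\<And>a r. a \<in> A \<Longrightarrow> r < N \<Longrightarrow> \<bar>a r\<bar> \<le> R"
    by (rule compactin_lp_bounded[OF assms]) (rule that)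
  let ?f = "\<lambda>t. magnitude (scale_dist t (lp_dist p N)) A"
  have spd: "stably_positive_definite (lp_dist p N) A"
    by (rule stably_positive_definite_lp[OF assms(1) R(2)])
  then have dim: "magnitude_dimension (lp_dist p N) A = growth ?f"
    by (simp add: magnitude_dimension_def)
  \<comment> \<open>Growth concerns large \<open>t\<close> only, so \<open>t \<ge> 1\<close> may be
    assumed throughout.\<close>
  have pd: "positive_definite (scale_dist t (lp_dist p N)) A" if "t \<ge> 1" for t
    using spd that by (simp add: stably_positive_definite_def)
  have SUP: "?f t = (SUP B\<in>{B. B \<subseteq> A \<and> finite B}. ereal (finite_magnitude (scale_dist t (lp_dist p N)) B))"
    if "t \<ge> 1" for t
    using pd[OF that] by (simp add: magnitude_def)
  obtain K where K: "\<And>t B. t \<ge> 1 \<Longrightarrow> B \<subseteq> lp_space N \<Longrightarrow> finite B \<Longrightarrow> \<forall>a\<in>B. \<forall>r<N. \<bar>a r\<bar> \<le> R \<Longrightarrow>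
      finite_magnitude (scale_dist t (lp_dist p N)) B \<le> K * t ^ N"
    by (rule finite_magnitude_lp_upper[OF assms(1) R(1), where N = N]) (rule that)
  have upper: "growth ?f \<le> ereal (real N)"
  proof (rule growth_le_power)
    show "?f t \<le> ereal (K * t ^ N)" if t: "t \<ge> 1" for t
      unfolding SUP[OF t]
    proof (rule SUP_least)
      fix B assume "B \<in> {B. B \<subseteq> A \<and> finite B}"
      then have "B \<subseteq> lp_space N" "finite B" "\<forall>a\<in>B. \<forall>r<N. \<bar>a r\<bar> \<le> R"
        using R(2,3) by blast+
      then have "finite_magnitude (scale_dist t (lp_dist p N)) B \<le> K * t ^ N"
        by (rule K[OF t])
      then show "ereal (finite_magnitude (scale_dist t (lp_dist p N)) B) \<le> ereal (K * t ^ N)" by simp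
    qed
  qed (intro positive_definite_nonneg_magnitude pd)
  moreover have "ereal (real N) \<le> growth ?f" if pos: "emeasure (lebesgue_power N) A > 0"
  proof -
    obtain c where c: "c > 0"
      "\<And>t. t > 0 \<Longrightarrow> \<exists>B\<subseteq>A. finite B \<and> c * t ^ N \<le> finite_magnitude (scale_dist t (lp_dist p N)) B"
    proof (rule finite_magnitude_lp_lower[OF assms(1) R(2) _ pos])
      show "\<bar>a r\<bar> \<le> R" if "a \<in> A" "r < N" for a r using that by (rule R(3))
    qed (rule that)
    show ?thesis
    proof (rule growth_ge_power[OF c(1)])
      fix t :: real assume t: "t \<ge> 1"
      then obtain B where "B \<subseteq> A" "finite B" "c * t ^ N \<le> finite_magnitude (scale_dist t (lp_dist p N)) B"
        using c(2)[of t] by auto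
      then show "ereal (c * t ^ N) \<le> ?f t"
        unfolding SUP[OF t] by (intro SUP_upper2[of B]) auto
    qed
  qed
  ultimately show ?thesis
    unfolding dim by (auto intro: antisym)
qed

end
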